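(* For every integer $d$ there exists a nontrivial snark $G$ with oddness $\omega(G)=2$ and colouring defect $\operatorname{df}(G)\ge d$. That is, there exist nontrivial snarks of oddness $2$ with arbitrarily large colouring defect.
   Context: Graphs are finite; multiple edges and loops are permitted. A snark is a $2$-connected cubic graph that admits no proper $3$-edge-colouring. A cubic graph is cyclically $k$-edge-connected if the removal of fewer than $k$ edges cannot create a graph with at least two components containing circuits. A snark is nontrivial if it is cyclically $4$-edge-connected and has girth at least $5$. The oddness $\omega(G)$ of a bridgeless cubic graph $G$ is the minimum number of odd circuits in a $2$-factor of $G$. The colouring defect $\operatorname{df}(G)$ of a cubic graph $G$ is the minimum, over all collections $\{M_1,M_2,M_3\}$ of three (not necessarily distinct) perfect matchings of $G$, of the number of edges of $G$ belonging to none of $M_1,M_2,M_3$. *)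

theory Defs
  imports "HOL-Library.Multiset" "HOL-Library.Extended_Nat"
begin

text \<open>
  Undirected multigraphs: an edge has a two-element multiset of ends, a loop at \<open>v\<close> being an edge
  with ends \<open>{#v, v#}\<close>. Distinct edges may have the same ends.
\<close>

record ('v, 'e) multigraph =
  verts :: "'v set"
  edges :: "'e set"
  ends :: "'e \<Rightarrow> 'v multiset"

definition finite_multigraph :: "('v, 'e) multigraph \<Rightarrow> bool" where
  "finite_multigraph G \<longleftrightarrow>
     finite (verts G) \<and> finite (edges G) \<and>
     (\<forall>e\<in>edges G. size (ends G e) = 2 \<and> set_mset (ends G e) \<subseteq> verts G)"

text \<open>A loop counts twice towards the degree.\<close>

definition degree :: "('v, 'e) multigraph \<Rightarrow> 'v \<Rightarrow> nat" where
  "degree G v = (\<Sum>e\<in>edges G. count (ends G e) v)"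

definition regular :: "nat \<Rightarrow> ('v, 'e) multigraph \<Rightarrow> bool" where
  "regular k G \<longleftrightarrow> (\<forall>v\<in>verts G. degree G v = k)"

definition cubic :: "('v, 'e) multigraph \<Rightarrow> bool" where
  "cubic G \<longleftrightarrow> regular 3 G"

definition spanning_subgraph :: "('v, 'e) multigraph \<Rightarrow> 'e set \<Rightarrow> ('v, 'e) multigraph" where
  "spanning_subgraph G F = G\<lparr>edges := F\<rparr>"

definition edge_induced_subgraph :: "('v, 'e) multigraph \<Rightarrow> 'e set \<Rightarrow> ('v, 'e) multigraph" where
  "edge_induced_subgraph G F = G\<lparr>verts := (\<Union>e\<in>F. set_mset (ends G e)), edges := F\<rparr>"

definition delete_edges :: "('v, 'e) multigraph \<Rightarrow> 'e set \<Rightarrow> ('v, 'e) multigraph" where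
  "delete_edges G S = G\<lparr>edges := edges G - S\<rparr>"

definition delete_verts :: "('v, 'e) multigraph \<Rightarrow> 'v set \<Rightarrow> ('v, 'e) multigraph" where
  "delete_verts G X =
     G\<lparr>verts := verts G - X, edges := {e \<in> edges G. set_mset (ends G e) \<inter> X = {}}\<rparr>"

definition adjacency :: "('v, 'e) multigraph \<Rightarrow> ('v \<times> 'v) set" where
  "adjacency G = {(u, v). \<exists>e\<in>edges G. ends G e = {#u, v#}}"

definition connected :: "('v, 'e) multigraph \<Rightarrow> bool" where
  "connected G \<longleftrightarrow> verts G \<noteq> {} \<and> (\<forall>u\<in>verts G. \<forall>v\<in>verts G. (u, v) \<in> (adjacency G)\<^sup>*)"

text \<open>The vertex sets of the connected components.\<close>

definition components :: "('v, 'e) multigraph \<Rightarrow> 'v set set" where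
  "components G = {{v \<in> verts G. (u, v) \<in> (adjacency G)\<^sup>*} |u. u \<in> verts G}"

definition k_connected :: "nat \<Rightarrow> ('v, 'e) multigraph \<Rightarrow> bool" where
  "k_connected k G \<longleftrightarrow>
     card (verts G) > k \<and> (\<forall>X\<subseteq>verts G. card X < k \<longrightarrow> connected (delete_verts G X))"

text \<open>
  A circuit (a connected 2-regular subgraph) is identified with its edge set; loops and pairs of
  parallel edges are circuits of length 1 and 2.
\<close>

definition circuit :: "('v, 'e) multigraph \<Rightarrow> 'e set \<Rightarrow> bool" where
  "circuit G C \<longleftrightarrow>
     C \<subseteq> edges G \<and> connected (edge_induced_subgraph G C) \<and> regular 2 (edge_induced_subgraph G C)"

definition girth :: "('v, 'e) multigraph \<Rightarrow> enat" where
  "girth G = (INF C\<in>{C. circuit G C}. enat (card C))"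

definition cyclically_edge_connected :: "nat \<Rightarrow> ('v, 'e) multigraph \<Rightarrow> bool" where
  "cyclically_edge_connected k G \<longleftrightarrow>
     \<not> (\<exists>S\<subseteq>edges G. card S < k \<and>
         card {K \<in> components (delete_edges G S).
                 \<exists>C. circuit (delete_edges G S) C \<and> (\<forall>e\<in>C. set_mset (ends G e) \<subseteq> K)} \<ge> 2)"

text \<open>A loop is adjacent to itself, so a graph with a loop has no proper edge-colouring.\<close>

definition proper_edge_colouring :: "('v, 'e) multigraph \<Rightarrow> nat \<Rightarrow> ('e \<Rightarrow> nat) \<Rightarrow> bool" where
  "proper_edge_colouring G k c \<longleftrightarrow>
     (\<forall>e\<in>edges G. c e < k) \<and>
     (\<forall>e\<in>edges G. \<forall>v. ends G e \<noteq> {#v, v#}) \<and>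
     (\<forall>e\<in>edges G. \<forall>f\<in>edges G. e \<noteq> f \<and> set_mset (ends G e) \<inter> set_mset (ends G f) \<noteq> {} \<longrightarrow> c e \<noteq> c f)"

definition snark :: "('v, 'e) multigraph \<Rightarrow> bool" where
  "snark G \<longleftrightarrow>
     finite_multigraph G \<and> k_connected 2 G \<and> cubic G \<and> \<not> (\<exists>c. proper_edge_colouring G 3 c)"

definition nontrivial_snark :: "('v, 'e) multigraph \<Rightarrow> bool" where
  "nontrivial_snark G \<longleftrightarrow> snark G \<and> cyclically_edge_connected 4 G \<and> girth G \<ge> 5"

definition two_factor :: "('v, 'e) multigraph \<Rightarrow> 'e set \<Rightarrow> bool" where
  "two_factor G F \<longleftrightarrow> F \<subseteq> edges G \<and> regular 2 (spanning_subgraph G F)"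

definition perfect_matching :: "('v, 'e) multigraph \<Rightarrow> 'e set \<Rightarrow> bool" where
  "perfect_matching G M \<longleftrightarrow> M \<subseteq> edges G \<and> regular 1 (spanning_subgraph G M)"

definition odd_circuits :: "('v, 'e) multigraph \<Rightarrow> 'e set \<Rightarrow> 'e set set" where
  "odd_circuits G F = {C. circuit (spanning_subgraph G F) C \<and> odd (card C)}"

text \<open>
  The two infima below are minima for bridgeless cubic graphs, which have 2-factors and perfect
  matchings by Petersen's theorem.
\<close>

definition oddness :: "('v, 'e) multigraph \<Rightarrow> nat" where
  "oddness G = (INF F\<in>{F. two_factor G F}. card (odd_circuits G F))"

definition colouring_defect :: "('v, 'e) multigraph \<Rightarrow> nat" where
  "colouring_defect G =
     Inf {card (edges G - (M1 \<union> M2 \<union> M3)) |M1 M2 M3.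
            perfect_matching G M1 \<and> perfect_matching G M2 \<and> perfect_matching G M3}"

end

(*
  Deleting a path u - c - w from the Petersen graph leaves a "bead" with two dangling edges at each of
  u, w and one at c. In every proper 3-edge-colouring of a bead exactly one of the two pairs of
  dangling edges is monochromatic. Put 3n beads into a ring and join the remaining dangling edges in
  triples to n hubs, such that hub k serves the beads 2k, 2k + 1 and 3n - 1 - k. Then the two pairs of
  ring edges before bead 2k and after bead 3n - 1 - k form a 4-edge cut, and by parity both pairs are
  monochromatic or neither is. Two beads lie between consecutive cuts on one side and a single bead
  on the other, so the beads of no hub can be properly coloured. As parity holds for any three perfect
  matchings, each hub has an uncovered edge near its beads, and the defect is at least n / 2. A flow
  through the whole chain repairs all beads at once at the price of a conflict at the first and at the
  last hub only, hence the oddness is 2.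
*)
theory Submission
  imports Defs
begin

section \<open>Cuts and 2-factors of finite multigraphs\<close>

text \<open>Why a bead alternates: seven vertices and five dangling edges, so by parity each colour
  occurs an odd number of times on the dangling edges, and the two pairs cannot both be
  monochromatic. If neither were, the colouring would extend over u, c and w to the Petersen graph,
  which has no proper 3-edge-colouring. The same alternation explains why n is taken even in the
  end: a colouring that is proper on every bead must alternate around a ring of 3n beads. The defect
  bound carries the rest. Since every three perfect matchings leave an edge uncovered, there is no
  proper 3-edge-colouring, whose classes would be three covering matchings. Nor can a 2-factor have
  only even circuits, for it would split into two perfect matchings that cover all edges together
  with its complement. As the number of vertices is even, an odd circuit always has an odd
  companion, which gives the lower bound 2 for the oddness. The bound n / 2 loses a factor 2 because
  a ring edge may lie between beads of two different hubs.\<close>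

definition edge_degree :: "('v, 'e) multigraph \<Rightarrow> 'e set \<Rightarrow> 'v \<Rightarrow> nat" where
  "edge_degree G F v = (\<Sum>e\<in>F. count (ends G e) v)"

definition covered_verts :: "('v, 'e) multigraph \<Rightarrow> 'e set \<Rightarrow> 'v set" where
  "covered_verts G F = (\<Union>e\<in>F. set_mset (ends G e))"

definition edge_cut :: "('v, 'e) multigraph \<Rightarrow> 'v set \<Rightarrow> 'e set" where
  "edge_cut G X = {e \<in> edges G. set_mset (ends G e) \<inter> X \<noteq> {} \<and> \<not> set_mset (ends G e) \<subseteq> X}"

lemma degree_spanning_subgraph [simp]: "degree (spanning_subgraph G F) v = edge_degree G F v"
  by (simp add: degree_def spanning_subgraph_def edge_degree_def)

lemma edges_spanning_subgraph [simp]: "edges (spanning_subgraph G F) = F"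
  and verts_spanning_subgraph [simp]: "verts (spanning_subgraph G F) = verts G"
  and ends_spanning_subgraph [simp]: "ends (spanning_subgraph G F) = ends G"
  by (simp_all add: spanning_subgraph_def)

lemma circuit_iff:
  "circuit G C \<longleftrightarrow> C \<subseteq> edges G \<and> connected (edge_induced_subgraph G C)
     \<and> (\<forall>v\<in>covered_verts G C. edge_degree G C v = 2)"
  by (simp add: circuit_def regular_def edge_induced_subgraph_def degree_def edge_degree_def
      covered_verts_def)

lemma circuit_spanning_subgraph:
  "F \<subseteq> edges G \<Longrightarrow> circuit (spanning_subgraph G F) C \<longleftrightarrow> C \<subseteq> F \<and> circuit G C"
  by (auto simp: circuit_def edge_induced_subgraph_def spanning_subgraph_def)

lemma circuit_delete_edges:
  "circuit (delete_edges G S) C \<longleftrightarrow> C \<subseteq> edges G - S \<and> circuit G C"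
  by (auto simp: circuit_def edge_induced_subgraph_def delete_edges_def)

lemma circuit_nonempty: "circuit G C \<Longrightarrow> C \<noteq> {}"
  by (auto simp: circuit_def connected_def edge_induced_subgraph_def)

lemma two_factor_iff:
  "two_factor G F \<longleftrightarrow> F \<subseteq> edges G \<and> (\<forall>v\<in>verts G. edge_degree G F v = 2)"
  by (simp add: two_factor_def regular_def)

lemma perfect_matching_iff:
  "perfect_matching G F \<longleftrightarrow> F \<subseteq> edges G \<and> (\<forall>v\<in>verts G. edge_degree G F v = 1)"
  by (simp add: perfect_matching_def regular_def)

lemma sym_adjacency: "sym (adjacency G)"
  unfolding sym_def adjacency_def by (auto simp: add_mset_commute)

lemma reachable_sym: "(u, v) \<in> (adjacency G)\<^sup>* \<Longrightarrow> (v, u) \<in> (adjacency G)\<^sup>*"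
  by (rule symD[OF sym_rtrancl[OF sym_adjacency]])

locale finite_graph =
  fixes G :: "('v, 'e) multigraph"
  assumes fin: "finite_multigraph G"
begin

lemma finite_verts [simp]: "finite (verts G)" and finite_edges [simp]: "finite (edges G)"
  using fin by (auto simp: finite_multigraph_def)

lemma finite_edge_subset: "F \<subseteq> edges G \<Longrightarrow> finite F"
  by (rule finite_subset) auto

lemma edge_ends:
  assumes "e \<in> edges G"
  obtains a b where "ends G e = {#a, b#}" "a \<in> verts G" "b \<in> verts G"
proof -
  have "size (ends G e) = 2" "set_mset (ends G e) \<subseteq> verts G"
    using fin assms by (auto simp: finite_multigraph_def)
  moreover from this(1) obtain a N where N: "ends G e = add_mset a N" "size N = 1"
    by (metis Suc_1 size_eq_Suc_imp_eq_union size_add_mset Suc_inject)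
  moreover from N(2) obtain b where "N = {#b#}" using size_1_singleton_mset by blast
  ultimately show ?thesis using that by auto
qed

lemma covered_verts_subset: "F \<subseteq> edges G \<Longrightarrow> covered_verts G F \<subseteq> verts G"
  using fin by (auto simp: covered_verts_def finite_multigraph_def)

lemma edge_degree_Diff:
  assumes "F \<subseteq> edges G" "J \<subseteq> F"
  shows "edge_degree G (F - J) v = edge_degree G F v - edge_degree G J v"
    and "edge_degree G J v \<le> edge_degree G F v"
proof -
  have "edge_degree G F v = edge_degree G (F - J) v + edge_degree G J v"
    unfolding edge_degree_def using assms finite_edge_subset by (intro sum.subset_diff) auto
  then show "edge_degree G (F - J) v = edge_degree G F v - edge_degree G J v"
    "edge_degree G J v \<le> edge_degree G F v" by auto
qed

text \<open>Handshake count over \<open>X\<close>: an edge inside contributes both ends, a cut edge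
  one. All parity arguments below rest on it.\<close>

lemma sum_edge_degree:
  assumes "F \<subseteq> edges G" "finite X"
  shows "(\<Sum>v\<in>X. edge_degree G F v) =
    2 * card {e\<in>F. set_mset (ends G e) \<subseteq> X} + card (F \<inter> edge_cut G X)"
proof -
  have fF: "finite F" using assms finite_edge_subset by auto
  have one: "(\<Sum>v\<in>X. count (ends G e) v) =
      2 * of_bool (set_mset (ends G e) \<subseteq> X) + of_bool (e \<in> edge_cut G X)" if "e \<in> F" for e
  proof -
    have eE: "e \<in> edges G" using that assms by auto
    then obtain a b where ab: "ends G e = {#a, b#}" by (rule edge_ends)
    have "count (ends G e) v = (if v = a then 1 else 0) + (if v = b then 1 else 0)" for v
      using ab by auto
    then have "(\<Sum>v\<in>X. count (ends G e) v) = of_bool (a \<in> X) + of_bool (b \<in> X)"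
      using \<open>finite X\<close> by (simp add: sum.distrib)
    then show ?thesis using ab eE by (auto simp: edge_cut_def)
  qed
  have "(\<Sum>v\<in>X. edge_degree G F v) = (\<Sum>e\<in>F. \<Sum>v\<in>X. count (ends G e) v)"
    unfolding edge_degree_def by (rule sum.swap)
  also have "\<dots> = (\<Sum>e\<in>F. 2 * of_bool (set_mset (ends G e) \<subseteq> X) + of_bool (e \<in> edge_cut G X))"
    using one by (intro sum.cong) auto
  also have "\<dots> = 2 * (\<Sum>e\<in>F. of_bool (set_mset (ends G e) \<subseteq> X)) + (\<Sum>e\<in>F. of_bool (e \<in> edge_cut G X))"
    by (simp only: sum.distrib sum_distrib_left)
  also have "\<dots> = 2 * card {e\<in>F. set_mset (ends G e) \<subseteq> X} + card (F \<inter> edge_cut G X)"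
    using fF by (simp add: Int_def)
  finally show ?thesis .
qed

text \<open>Handshake count over the covered vertices, which no edge of \<open>C\<close> leaves. It
  lets the parity of a circuit be read off its vertices.\<close>

lemma card_circuit:
  assumes "circuit G C"
  shows "card (covered_verts G C) = card C"
proof -
  have C: "C \<subseteq> edges G" "\<forall>v\<in>covered_verts G C. edge_degree G C v = 2"
    using assms by (auto simp: circuit_iff)
  have "finite (covered_verts G C)" by (rule finite_subset[OF covered_verts_subset[OF C(1)] finite_verts])
  from sum_edge_degree[OF C(1) this]
  have "2 * card (covered_verts G C) = 2 * card {e\<in>C. set_mset (ends G e) \<subseteq> covered_verts G C}
      + card (C \<inter> edge_cut G (covered_verts G C))"
    using C(2) by simp
  moreover have "{e\<in>C. set_mset (ends G e) \<subseteq> covered_verts G C} = C"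
    by (auto simp: covered_verts_def)
  moreover have "C \<inter> edge_cut G (covered_verts G C) = {}"
    by (auto simp: covered_verts_def edge_cut_def)
  ultimately show ?thesis by simp
qed

lemma edge_degree_pos_imp_edge:
  assumes "0 < edge_degree G F v"
  shows "\<exists>e\<in>F. v \<in># ends G e"
proof (rule ccontr)
  assume "\<not> ?thesis"
  then have "count (ends G e) v = 0" if "e \<in> F" for e
    using that by (simp add: not_in_iff)
  then show False using assms by (simp add: edge_degree_def)
qed

lemma edge_degree_pos:
  assumes "F \<subseteq> edges G" "e \<in> F" "v \<in># ends G e"
  shows "0 < edge_degree G F v"
  unfolding edge_degree_def using assms finite_edge_subset
  by (intro sum_pos2[where i = e]) auto

text \<open>The parity lemma: the vertices of \<open>X\<close> that are not matched across the cut
  are matched among themselves in pairs.\<close>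

lemma perfect_matching_cut_parity:
  assumes "perfect_matching G M" "X \<subseteq> verts G"
  shows "even (card (M \<inter> edge_cut G X)) \<longleftrightarrow> even (card X)"
proof -
  have M: "M \<subseteq> edges G" "\<forall>v\<in>verts G. edge_degree G M v = 1"
    using assms by (auto simp: perfect_matching_iff)
  have "finite X" using assms(2) by (rule finite_subset) simp
  from sum_edge_degree[OF M(1) this]
  have "card X = 2 * card {e\<in>M. set_mset (ends G e) \<subseteq> X} + card (M \<inter> edge_cut G X)"
    using M(2) assms(2) by (simp add: subset_iff)
  then show ?thesis by presburger
qed

text \<open>The circuit already uses both \<open>F\<close>-edges at each of its vertices, so no
  third one is left.\<close>

lemma circuit_absorbs:
  assumes F: "F \<subseteq> edges G" "\<forall>v\<in>verts G. edge_degree G F v = 2"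
    and C: "circuit G C" "C \<subseteq> F" and v: "v \<in> covered_verts G C"
    and e: "e \<in> F" "v \<in># ends G e"
  shows "e \<in> C"
proof (rule ccontr)
  assume "e \<notin> C"
  have "v \<in> verts G" using v C F covered_verts_subset[of C] by auto
  then have "edge_degree G F v = 2" "edge_degree G C v = 2"
    using F C v by (auto simp: circuit_iff)
  then have "edge_degree G (F - C) v = 0" using edge_degree_Diff[OF F(1) C(2)] by simp
  moreover have "0 < edge_degree G (F - C) v"
    by (rule edge_degree_pos[of _ e]) (use F e \<open>e \<notin> C\<close> in auto)
  ultimately show False by simp
qed

text \<open>A walk along one circuit that starts on the other can never leave it, by
  \<open>circuit_absorbs\<close>.\<close>

lemma circuit_eqI:
  assumes F: "two_factor G F"
    and C: "circuit G C" "C \<subseteq> F" and D: "circuit G D" "D \<subseteq> F"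
    and v: "v \<in> covered_verts G C" "v \<in> covered_verts G D"
  shows "C = D"
proof -
  have sub: "D \<subseteq> C" if C: "circuit G C" "C \<subseteq> F" and D: "circuit G D" "D \<subseteq> F"
    and v: "v \<in> covered_verts G C" "v \<in> covered_verts G D" for C D
  proof
    have F': "F \<subseteq> edges G" "\<forall>v\<in>verts G. edge_degree G F v = 2"
      using F by (auto simp: two_factor_iff)
    note absorbs = circuit_absorbs[OF F' C]
    fix e assume e: "e \<in> D"
    then have "e \<in> edges G" using D F' by auto
    then obtain a b where ab: "ends G e = {#a, b#}" by (rule edge_ends)
    then have "a \<in># ends G e" by simp
    then have "a \<in> covered_verts G D" using e unfolding covered_verts_def by blast
    then have "(v, a) \<in> (adjacency (edge_induced_subgraph G D))\<^sup>*"
      using D(1) v(2) by (auto simp: circuit_def connected_def edge_induced_subgraph_def covered_verts_def)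
    then have "a \<in> covered_verts G C"
    proof (induction rule: rtrancl_induct)
      case base then show ?case using v by simp
    next
      case (step y z)
      then obtain f where f: "f \<in> D" "ends G f = {#y, z#}"
        by (auto simp: adjacency_def edge_induced_subgraph_def)
      then have "f \<in> C" using absorbs[of y f] step.IH D(2) by auto
      moreover have "z \<in># ends G f" using f by simp
      ultimately show ?case unfolding covered_verts_def by blast
    qed
    then show "e \<in> C" using absorbs[of a e] e D(2) \<open>a \<in># ends G e\<close> by blast
  qed
  show ?thesis by (rule subset_antisym[OF sub[OF D C v(2) v(1)] sub[OF C D v]])
qed

text \<open>If deleting at most one vertex separates \<open>K\<close> from the rest, every edge of
  the cuts of \<open>K\<close> and of the rest ends at the deleted vertex. The two cuts are disjoint
  and have at least two edges each, but a vertex has only three.\<close>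

lemma k_connected_2I:
  assumes cubic: "cubic G" and big: "2 < card (verts G)"
    and cut: "\<And>Z. Z \<noteq> {} \<Longrightarrow> Z \<subset> verts G \<Longrightarrow> 2 \<le> card (edge_cut G Z)"
  shows "k_connected 2 G"
  unfolding k_connected_def
proof (intro conjI allI impI big)
  fix X assume X: "X \<subseteq> verts G" "card X < 2"
  let ?H = "delete_verts G X"
  have fX: "finite X" using X(1) by (rule finite_subset) simp
  have "card (verts G - X) = card (verts G) - card X" using X(1) fX by (intro card_Diff_subset)
  then have "0 < card (verts G - X)" using big X(2) by linarith
  then have ne: "verts ?H \<noteq> {}" by (simp add: card_gt_0_iff delete_verts_def)
  have "(u, w) \<in> (adjacency ?H)\<^sup>*" if u: "u \<in> verts ?H" and w: "w \<in> verts ?H" for u w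
  proof (rule ccontr)
    assume uw: "(u, w) \<notin> (adjacency ?H)\<^sup>*"
    define K where "K = {z \<in> verts G - X. (u, z) \<in> (adjacency ?H)\<^sup>*}"
    let ?K' = "verts G - X - K"
    have uK: "u \<in> K" and wK: "w \<in> ?K'" using u w uw by (auto simp: K_def delete_verts_def)
    have step: "b \<in> K" if "e \<in> edges G" "ends G e = {#a, b#}" "a \<in> K" "b \<in> verts G - X" for e a b
    proof -
      have "(a, b) \<in> adjacency ?H" using that by (auto simp: adjacency_def delete_verts_def K_def)
      then show ?thesis using that by (auto simp: K_def intro: rtrancl_into_rtrancl)
    qed
    have cutK: "\<exists>x\<in>X. x \<in># ends G e" if e: "e \<in> edge_cut G K \<union> edge_cut G ?K'" for e
    proof -
      have "e \<in> edges G" using e by (auto simp: edge_cut_def)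
      then obtain a b where ab: "ends G e = {#a, b#}" "a \<in> verts G" "b \<in> verts G" by (rule edge_ends)
      have ba: "ends G e = {#b, a#}" using ab(1) by (simp add: add_mset_commute)
      show ?thesis
      proof (rule ccontr)
        assume "\<not> ?thesis"
        then have X: "a \<notin> X" "b \<notin> X" using ab(1) by auto
        then have "a \<in> K \<longleftrightarrow> b \<in> K"
          using step[OF \<open>e \<in> edges G\<close> ab(1)] step[OF \<open>e \<in> edges G\<close> ba] ab(2,3) by blast
        then show False using e ab X by (simp add: edge_cut_def)
      qed
    qed
    have disj: "edge_cut G K \<inter> edge_cut G ?K' = {}"
    proof (rule ccontr)
      assume "edge_cut G K \<inter> edge_cut G ?K' \<noteq> {}"
      then obtain e where e: "e \<in> edge_cut G K" "e \<in> edge_cut G ?K'" by blast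
      then have "e \<in> edges G" by (simp add: edge_cut_def)
      then obtain a b where "ends G e = {#a, b#}" by (rule edge_ends)
      moreover obtain x where "x \<in> X" "x \<in># ends G e" using cutK e by blast
      ultimately show False using e by (auto simp: edge_cut_def K_def)
    qed
    have fc: "finite (edge_cut G Z)" for Z by (rule finite_subset[of _ "edges G"]) (auto simp: edge_cut_def)
    have "2 \<le> card (edge_cut G K)"
    proof (rule cut)
      show "K \<noteq> {}" using uK by blast
      show "K \<subset> verts G" using wK K_def by auto
    qed
    moreover have "2 \<le> card (edge_cut G ?K')"
    proof (rule cut)
      show "?K' \<noteq> {}" using wK by blast
      show "?K' \<subset> verts G" using uK K_def by auto
    qed
    ultimately have four: "4 \<le> card (edge_cut G K \<union> edge_cut G ?K')"
      using card_Un_disjoint[OF fc fc disj] by linarith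
    then have "edge_cut G K \<union> edge_cut G ?K' \<noteq> {}" by (intro notI) simp
    then obtain v where "v \<in> X" using cutK by blast
    have "card X \<le> Suc 0" using X(2) by simp
    then have Xv: "X = {v}" using \<open>v \<in> X\<close> card_le_Suc0_iff_eq[OF fX] by blast
    have "4 \<le> (\<Sum>e\<in>edge_cut G K \<union> edge_cut G ?K'. 1 :: nat)" using four by simp
    also have "\<dots> \<le> (\<Sum>e\<in>edge_cut G K \<union> edge_cut G ?K'. count (ends G e) v)"
    proof (rule sum_mono)
      fix e assume "e \<in> edge_cut G K \<union> edge_cut G ?K'"
      then have "v \<in># ends G e" using cutK Xv by blast
      then show "1 \<le> count (ends G e) v" by simp
    qed
    also have "\<dots> \<le> degree G v"
      unfolding degree_def by (rule sum_mono2) (auto simp: edge_cut_def)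
    also have "\<dots> = 3" using cubic \<open>v \<in> X\<close> X(1) by (auto simp: cubic_def regular_def)
    finally show False by simp
  qed
  then show "connected ?H" using ne by (simp add: connected_def)
qed

lemma circuit_degree_cases:
  assumes "circuit G C"
  shows "edge_degree G C v = 0 \<or> edge_degree G C v = 2"
  using assms edge_degree_pos_imp_edge[of C v] by (auto simp: circuit_iff covered_verts_def)

text \<open>Edges common to \<open>J\<close> and \<open>P\<close> are counted in both degrees and
  cancel modulo 2. This is what makes switching along a path work.\<close>

lemma odd_edge_degree_sym_diff:
  "odd (edge_degree G (sym_diff J P) v) \<longleftrightarrow> odd (edge_degree G J v) \<noteq> odd (edge_degree G P v)"
  if "J \<subseteq> edges G" "P \<subseteq> edges G"
proof -
  have f: "finite J" "finite P" using that finite_edge_subset by auto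
  have J: "edge_degree G J v = edge_degree G (J \<inter> P) v + edge_degree G (J - P) v"
    unfolding edge_degree_def using f by (intro sum.Int_Diff)
  have P: "edge_degree G P v = edge_degree G (J \<inter> P) v + edge_degree G (P - J) v"
    unfolding edge_degree_def Int_commute[of J P] using f by (intro sum.Int_Diff)
  have "edge_degree G (sym_diff J P) v = edge_degree G (J - P) v + edge_degree G (P - J) v"
    unfolding edge_degree_def using f by (intro sum.union_disjoint) auto
  then show ?thesis using J P by auto
qed

text \<open>Follow a walk from \<open>u\<close> to \<open>v\<close> and toggle each edge on it:
  edges traversed twice cancel, and only the two ends keep odd degree. For \<open>u = v\<close> all
  degrees are even.\<close>

lemma path_join:
  assumes F: "F \<subseteq> edges G" and uv: "(u, v) \<in> (adjacency (spanning_subgraph G F))\<^sup>*"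
  shows "\<exists>P\<subseteq>F. \<forall>w. odd (edge_degree G P w) \<longleftrightarrow> (w = u) \<noteq> (w = v)"
  using uv
proof (induction rule: rtrancl_induct)
  case base
  show ?case by (intro exI[of _ "{}"]) (auto simp: edge_degree_def)
next
  case (step y z)
  then obtain P where P: "P \<subseteq> F" "\<forall>w. odd (edge_degree G P w) \<longleftrightarrow> (w = u) \<noteq> (w = y)" by auto
  from step(2) obtain e where e: "e \<in> F" "ends G e = {#y, z#}" by (auto simp: adjacency_def)
  have "odd (edge_degree G {e} w) \<longleftrightarrow> (w = y) \<noteq> (w = z)" for w
    using e by (auto simp: edge_degree_def)
  moreover have "P \<subseteq> edges G" "{e} \<subseteq> edges G" using P e F by auto
  ultimately have "odd (edge_degree G (sym_diff P {e}) w) \<longleftrightarrow> (w = u) \<noteq> (w = z)" for w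
    using odd_edge_degree_sym_diff[of P "{e}" w] P(2) by blast
  moreover have "sym_diff P {e} \<subseteq> F" using P e by auto
  ultimately show ?case by blast
qed

section \<open>Components of a 2-factor and its splitting into perfect matchings\<close>

definition component :: "'e set \<Rightarrow> 'v \<Rightarrow> 'v set" where
  "component F u = {v\<in>verts G. (u, v) \<in> (adjacency (spanning_subgraph G F))\<^sup>*}"

lemma component_self: "u \<in> verts G \<Longrightarrow> u \<in> component F u"
  by (simp add: component_def)

lemma component_subset: "component F u \<subseteq> verts G"
  by (auto simp: component_def)

lemma finite_component [simp]: "finite (component F u)"
  by (rule finite_subset[OF component_subset finite_verts])

lemma component_closed:
  assumes "F \<subseteq> edges G" "e \<in> F" "v \<in># ends G e" "v \<in> component F u"
  shows "set_mset (ends G e) \<subseteq> component F u"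
proof -
  have "e \<in> edges G" using assms by auto
  then obtain a b where ab: "ends G e = {#a, b#}" "a \<in> verts G" "b \<in> verts G" by (rule edge_ends)
  then have "(a, b) \<in> adjacency (spanning_subgraph G F)" "(b, a) \<in> adjacency (spanning_subgraph G F)"
    using assms by (auto simp: adjacency_def add_mset_commute)
  then show ?thesis using assms ab by (auto simp: component_def intro: rtrancl_into_rtrancl)
qed

lemma component_cut: "F \<subseteq> edges G \<Longrightarrow> F \<inter> edge_cut G (component F u) = {}"
  using component_closed[of F _ _ u] by (auto simp: edge_cut_def)

lemma component_least:
  assumes "F \<inter> edge_cut G X = {}" "F \<subseteq> edges G" "u \<in> X"
  shows "component F u \<subseteq> X"
proof
  fix v assume "v \<in> component F u"
  then have "(u, v) \<in> (adjacency (spanning_subgraph G F))\<^sup>*" by (simp add: component_def)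
  then show "v \<in> X"
  proof (induction rule: rtrancl_induct)
    case (step y z)
    then obtain e where "e \<in> F" "ends G e = {#y, z#}" by (auto simp: adjacency_def)
    then show ?case using step.IH assms(1,2) by (auto simp: edge_cut_def)
  qed (use assms in simp)
qed

text \<open>No edge of \<open>F\<close> leaves a component, so its vertices keep degree 2 inside it:
  the circuits of a 2-factor are its components, and their lengths are the component sizes.\<close>

lemma component_circuit:
  assumes F: "two_factor G F" and u: "u \<in> verts G"
  defines "C \<equiv> {e\<in>F. set_mset (ends G e) \<subseteq> component F u}"
  shows "circuit G C" "covered_verts G C = component F u" "card C = card (component F u)"
proof -
  have FE: "F \<subseteq> edges G" and d2: "\<And>v. v \<in> verts G \<Longrightarrow> edge_degree G F v = 2"
    using F by (auto simp: two_factor_iff)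
  have CF: "C \<subseteq> F" by (auto simp: C_def)
  have inC: "e \<in> C" if "e \<in> F" "v \<in># ends G e" "v \<in> component F u" for e v
    using component_closed[OF FE that] that by (auto simp: C_def)
  have deg: "edge_degree G C v = 2" if v: "v \<in> component F u" for v
  proof -
    have "edge_degree G (F - C) v = 0"
      using edge_degree_pos_imp_edge[of "F - C" v] inC v by blast
    moreover have "edge_degree G F v = 2" using v component_subset d2 by blast
    ultimately show ?thesis using edge_degree_Diff[OF FE CF, of v] by simp
  qed
  show cov: "covered_verts G C = component F u"
  proof
    show "covered_verts G C \<subseteq> component F u" by (auto simp: covered_verts_def C_def)
    show "component F u \<subseteq> covered_verts G C"
    proof
      fix v assume "v \<in> component F u"
      then have "0 < edge_degree G C v" using deg by simp
      then show "v \<in> covered_verts G C"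
        using edge_degree_pos_imp_edge by (fastforce simp: covered_verts_def)
    qed
  qed
  have reach: "(u, v) \<in> (adjacency (edge_induced_subgraph G C))\<^sup>*" if "v \<in> component F u" for v
  proof -
    from that have "(u, v) \<in> (adjacency (spanning_subgraph G F))\<^sup>*" by (simp add: component_def)
    then have "v \<in> component F u \<and> (u, v) \<in> (adjacency (edge_induced_subgraph G C))\<^sup>*"
    proof (induction rule: rtrancl_induct)
      case base then show ?case using component_self[OF u] by simp
    next
      case (step y z)
      then obtain e where e: "e \<in> F" "ends G e = {#y, z#}" by (auto simp: adjacency_def)
      then have "e \<in> C" using inC[of e y] step.IH by auto
      then have "(y, z) \<in> adjacency (edge_induced_subgraph G C)"
        using e by (auto simp: adjacency_def edge_induced_subgraph_def)
      moreover have "z \<in> component F u" using \<open>e \<in> C\<close> e by (auto simp: C_def)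
      ultimately show ?case using step.IH by (meson rtrancl_into_rtrancl)
    qed
    then show ?thesis by simp
  qed
  have "connected (edge_induced_subgraph G C)"
    unfolding connected_def
  proof (intro conjI ballI)
    have verts: "verts (edge_induced_subgraph G C) = component F u"
      using cov by (simp add: edge_induced_subgraph_def covered_verts_def)
    then show "verts (edge_induced_subgraph G C) \<noteq> {}" using component_self[OF u] by auto
    fix a b assume "a \<in> verts (edge_induced_subgraph G C)" "b \<in> verts (edge_induced_subgraph G C)"
    then have "a \<in> component F u" "b \<in> component F u" using verts by simp_all
    then show "(a, b) \<in> (adjacency (edge_induced_subgraph G C))\<^sup>*"
      by (rule rtrancl_trans[OF reachable_sym[OF reach] reach])
  qed
  then show circ: "circuit G C" using deg by (simp add: circuit_iff cov subset_trans[OF CF FE])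
  show "card C = card (component F u)" using card_circuit[OF circ] cov by simp
qed

text \<open>A set that \<open>F\<close> does not leave is a union of components. Removing an even
  one leaves a smaller set of the same kind that is still odd.\<close>

lemma odd_closed_set_component:
  assumes F: "F \<subseteq> edges G" and X: "X \<subseteq> verts G" "F \<inter> edge_cut G X = {}" "odd (card X)"
  shows "\<exists>u\<in>X. odd (card (component F u))"
  using X
proof (induction "card X" arbitrary: X rule: less_induct)
  case less
  have fX: "finite X" using less.prems(1) by (rule finite_subset) simp
  from less.prems(3) obtain u where u: "u \<in> X" by fastforce
  then have K: "u \<in> component F u" "component F u \<subseteq> X"
    using less.prems component_least[OF _ F] component_self by auto
  show ?case
  proof (cases "odd (card (component F u))")
    case True then show ?thesis using u by blast
  next
    case False
    let ?Y = "X - component F u"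
    have "card X = card ?Y + card (component F u)"
      using K fX by (metis card_Diff_subset card_mono finite_subset le_add_diff_inverse2)
    then have "odd (card ?Y)" using less.prems(3) False by auto
    moreover have "card ?Y < card X" using K fX by (intro psubset_card_mono) auto
    moreover have "F \<inter> edge_cut G ?Y = {}"
      using less.prems(2) component_cut[OF F, of u] F by (auto simp: edge_cut_def)
    ultimately have "\<exists>v\<in>?Y. odd (card (component F v))"
      using less.hyps[of ?Y] less.prems(1) by blast
    then show ?thesis by blast
  qed
qed

text \<open>The complement of an odd component has odd size and is not left by \<open>F\<close>
  either, so it contains a second odd component.\<close>

lemma two_odd_circuits:
  assumes F: "two_factor G F" and even: "even (card (verts G))"
    and u: "u \<in> verts G" "odd (card (component F u))"
  shows "2 \<le> card (odd_circuits G F)"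
proof -
  have FE: "F \<subseteq> edges G" using F by (auto simp: two_factor_iff)
  let ?X = "verts G - component F u"
  let ?C = "\<lambda>u. {e\<in>F. set_mset (ends G e) \<subseteq> component F u}"
  have "card (verts G) = card ?X + card (component F u)"
    using component_subset by (metis card_Diff_subset card_mono finite_component finite_verts le_add_diff_inverse2)
  then have "odd (card ?X)" using even u by auto
  moreover have "F \<inter> edge_cut G ?X = {}"
  proof -
    have "set_mset (ends G e) \<subseteq> verts G" if "e \<in> F" for e
      using that FE fin by (auto simp: finite_multigraph_def)
    then show ?thesis using component_cut[OF FE, of u] FE by (fastforce simp: edge_cut_def)
  qed
  ultimately obtain w where w: "w \<in> ?X" "odd (card (component F w))"
    using odd_closed_set_component[OF FE, of ?X] by auto
  from w have wV: "w \<in> verts G" by simp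
  have "component F u \<noteq> component F w" using w component_self[OF wV] by auto
  then have "?C u \<noteq> ?C w"
    using component_circuit(2)[OF F u(1)] component_circuit(2)[OF F wV] by metis
  moreover have "?C u \<in> odd_circuits G F" "?C w \<in> odd_circuits G F"
    unfolding odd_circuits_def mem_Collect_eq circuit_spanning_subgraph[OF FE]
    using component_circuit(1,3)[OF F u(1)] component_circuit(1,3)[OF F wV] u(2) w(2) by simp_all
  moreover have "finite (odd_circuits G F)"
    by (rule finite_subset[of _ "Pow F"])
      (use FE finite_edge_subset in \<open>auto simp: odd_circuits_def circuit_spanning_subgraph\<close>)
  ultimately show ?thesis
    using card_mono[of "odd_circuits G F" "{?C u, ?C w}"] by auto
qed

text \<open>
  Choose the edge set with the largest number of odd degrees: two vertices of even degree in the
  same component could be made odd by switching along a path joining them.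
\<close>

lemma two_factor_splits:
  assumes F: "two_factor G F" and even: "\<And>u. u \<in> verts G \<Longrightarrow> even (card (component F u))"
  shows "\<exists>J\<subseteq>F. perfect_matching G J \<and> perfect_matching G (F - J)"
proof -
  have FE: "F \<subseteq> edges G" and d2: "\<And>v. v \<in> verts G \<Longrightarrow> edge_degree G F v = 2"
    using F by (auto simp: two_factor_iff)
  define T where "T J = {v\<in>verts G. odd (edge_degree G J v)}" for J
  have "card (T J) < Suc (card (verts G))" for J
    unfolding less_Suc_eq_le by (rule card_mono) (auto simp: T_def)
  then have "\<exists>J. J \<subseteq> F \<and> (\<forall>J'. J' \<subseteq> F \<longrightarrow> card (T J') \<le> card (T J))"
    by (intro ex_has_greatest_nat[of "\<lambda>J. J \<subseteq> F" F "\<lambda>J. card (T J)"]) auto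
  then obtain J where J: "J \<subseteq> F" "\<And>J'. J' \<subseteq> F \<Longrightarrow> card (T J') \<le> card (T J)"
    by (elim exE conjE) simp
  have odd: "odd (edge_degree G J u)" if u: "u \<in> verts G" for u
  proof (rule ccontr)
    assume eu: "\<not> odd (edge_degree G J u)"
    let ?K = "component F u"
    have "J \<inter> edge_cut G ?K = {}" using component_cut[OF FE] J(1) by blast
    then have "even (\<Sum>v\<in>?K. edge_degree G J v)"
      using sum_edge_degree[of J ?K] J(1) FE by auto
    then have "even (card {v\<in>?K. odd (edge_degree G J v)})"
      using even_sum_iff[of ?K "edge_degree G J"] by simp
    moreover have "card ?K = card {v\<in>?K. odd (edge_degree G J v)} + card {v\<in>?K. even (edge_degree G J v)}"
      by (subst card_Un_disjoint[symmetric]) (auto intro: arg_cong[where f = card])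
    ultimately have "even (card {v\<in>?K. even (edge_degree G J v)})"
      using even[OF u] by auto
    \<comment> \<open>The component has even size and evenly many vertices of odd degree, hence
      evenly many of even degree; \<open>u\<close> cannot be the only one.\<close>
    then have "{v\<in>?K. even (edge_degree G J v)} \<noteq> {u}" by auto
    moreover have "u \<in> {v\<in>?K. even (edge_degree G J v)}" using eu component_self[OF u] by auto
    ultimately obtain v where v: "v \<in> ?K" "even (edge_degree G J v)" "v \<noteq> u" by blast
    then obtain P where P: "P \<subseteq> F" "\<forall>w. odd (edge_degree G P w) \<longleftrightarrow> (w = u) \<noteq> (w = v)"
      using path_join[OF FE, of u v] by (auto simp: component_def)
    have "J \<subseteq> edges G" "P \<subseteq> edges G" using P J(1) FE by auto
    then have *: "odd (edge_degree G (sym_diff J P) w) \<longleftrightarrow>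
        (odd (edge_degree G J w) \<noteq> ((w = u) \<noteq> (w = v)))" for w
      using odd_edge_degree_sym_diff[of J P w] P(2) by blast
    have "T J \<subset> T (sym_diff J P)"
      using eu v u by (auto simp: T_def *)
    then have "card (T J) < card (T (sym_diff J P))"
      by (intro psubset_card_mono) (auto simp: T_def)
    then show False using J(2)[of "sym_diff J P"] J(1) P(1) by auto
  qed
  have one: "edge_degree G J v = 1" if "v \<in> verts G" for v
  proof -
    have "edge_degree G J v \<le> 2" using edge_degree_Diff(2)[OF FE J(1), of v] d2[OF that] by simp
    then show ?thesis using odd[OF that] by presburger
  qed
  then have "perfect_matching G J" "perfect_matching G (F - J)"
    using J(1) FE d2 edge_degree_Diff(1)[OF FE J(1)] by (auto simp: perfect_matching_iff)
  then show ?thesis using J(1) by blast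
qed

text \<open>Otherwise \<open>F\<close> has no odd circuit and splits into two perfect matchings; the
  complement of \<open>F\<close> is a third one, and together they cover every edge.\<close>

lemma oddness_ge_2:
  assumes cubic: "cubic G" and even: "even (card (verts G))" and F: "two_factor G F"
    and nocover: "\<And>M1 M2 M3. perfect_matching G M1 \<Longrightarrow> perfect_matching G M2 \<Longrightarrow>
      perfect_matching G M3 \<Longrightarrow> edges G - (M1 \<union> M2 \<union> M3) \<noteq> {}"
  shows "2 \<le> card (odd_circuits G F)"
proof (rule ccontr)
  assume "\<not> ?thesis"
  then have "\<And>u. u \<in> verts G \<Longrightarrow> even (card (component F u))"
    using two_odd_circuits[OF F even] by blast
  then obtain J where J: "J \<subseteq> F" "perfect_matching G J" "perfect_matching G (F - J)"
    using two_factor_splits[OF F] by blast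
  have FE: "F \<subseteq> edges G" using F by (simp add: two_factor_iff)
  have "edge_degree G (edges G) v = 3" if "v \<in> verts G" for v
    using cubic that by (simp add: cubic_def regular_def degree_def edge_degree_def)
  then have "perfect_matching G (edges G - F)"
    using edge_degree_Diff(1)[OF subset_refl FE] F by (auto simp: perfect_matching_iff two_factor_iff)
  from nocover[OF J(2) J(3) this] show False by auto
qed

text \<open>On a circuit that avoids \<open>B\<close>, the set \<open>J\<close> would match the
  vertices perfectly, so the circuit would be even. Hence every odd circuit meets \<open>B\<close>,
  and distinct circuits of a 2-factor are disjoint.\<close>

lemma card_odd_circuits_le:
  assumes F: "two_factor G F" and J: "J \<subseteq> F" and B: "finite B"
    and one: "\<And>v. v \<in> verts G - B \<Longrightarrow> edge_degree G J v = 1"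
  shows "card (odd_circuits G F) \<le> card B"
proof -
  have FE: "F \<subseteq> edges G" "\<forall>v\<in>verts G. edge_degree G F v = 2" using F by (auto simp: two_factor_iff)
  have odd: "circuit G C" "C \<subseteq> F" "odd (card C)" if "C \<in> odd_circuits G F" for C
    using that by (auto simp: odd_circuits_def circuit_spanning_subgraph[OF FE(1)])
  have "\<exists>v. v \<in> covered_verts G C \<and> v \<in> B" if C: "C \<in> odd_circuits G F" for C
  proof (rule ccontr)
    assume neg: "\<not> ?thesis"
    let ?X = "covered_verts G C"
    have XV: "?X \<subseteq> verts G" using odd(2)[OF C] FE(1) covered_verts_subset by (meson subset_trans)
    have deg: "edge_degree G (J \<inter> C) v = 1" if v: "v \<in> ?X" for v
    proof -
      have "edge_degree G (J - C) v = 0"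
        using edge_degree_pos_imp_edge[of "J - C" v] circuit_absorbs[OF FE odd(1,2)[OF C] v] J by blast
      moreover have "J - (J \<inter> C) = J - C" by blast
      moreover have "edge_degree G J v = 1" using one v neg XV by blast
      moreover have "J \<subseteq> edges G" using J FE(1) by blast
      ultimately show ?thesis
        using edge_degree_Diff[of J "J \<inter> C" v] by auto
    qed
    have fX: "finite ?X" using XV by (rule finite_subset) simp
    have "J \<inter> C \<subseteq> edges G" using J FE(1) by blast
    from sum_edge_degree[OF this fX] have
      "card ?X = 2 * card {e \<in> J \<inter> C. set_mset (ends G e) \<subseteq> ?X} + card (J \<inter> C \<inter> edge_cut G ?X)"
      using deg by simp
    moreover have "J \<inter> C \<inter> edge_cut G ?X = {}" by (auto simp: edge_cut_def covered_verts_def)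
    ultimately have "even (card ?X)" by simp
    then show False using card_circuit[OF odd(1)[OF C]] odd(3)[OF C] by simp
  qed
  then obtain s where s: "\<And>C. C \<in> odd_circuits G F \<Longrightarrow> s C \<in> covered_verts G C \<and> s C \<in> B" by metis
  have "inj_on s (odd_circuits G F)"
  proof (rule inj_onI)
    fix C D assume CD: "C \<in> odd_circuits G F" "D \<in> odd_circuits G F" "s C = s D"
    then show "C = D"
      using circuit_eqI[OF F odd(1,2)[OF CD(1)] odd(1,2)[OF CD(2)], of "s C"] s by metis
  qed
  then show ?thesis using s B by (intro card_inj_on_le[of s]) auto
qed

end

section \<open>The necklace graphs\<close>

abbreviation vx :: "nat \<Rightarrow> nat \<Rightarrow> nat" where "vx l j \<equiv> prod_encode (l, j)"
abbreviation ed :: "nat \<Rightarrow> nat \<Rightarrow> nat" where "ed l t \<equiv> prod_encode (l, t)"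

text \<open>A case split instead of \<open>mod\<close> keeps the laws of the cyclic order within
  linear arithmetic.\<close>

definition ring_succ :: "nat \<Rightarrow> nat \<Rightarrow> nat" where
  "ring_succ n l = (if Suc l = 3 * n then 0 else Suc l)"

definition ring_pred :: "nat \<Rightarrow> nat \<Rightarrow> nat" where
  "ring_pred n l = (if l = 0 then 3 * n - 1 else l - 1)"

text \<open>The beads from \<open>2 * n\<close> on are assigned in reverse, so that for every
  \<open>k\<close> the beads of the first \<open>k\<close> hubs form one arc of the ring around the
  junction of beads \<open>3 * n - 1\<close> and 0.\<close>

definition hub :: "nat \<Rightarrow> nat \<Rightarrow> nat" where
  "hub n l = (if l < 2 * n then l div 2 else 3 * n - 1 - l)"

text \<open>
  Bead \<open>l\<close> has the vertices \<open>vx l 0\<close>, \<dots>, \<open>vx l 6\<close>: the first six form a hexagon (edges 0 to 5) and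
  \<open>vx l 6\<close> is joined to two opposite vertices of it (edges 6 and 7). Edges 8 and 9 lead to the next bead,
  edge 10 leads to the hub. The hubs are the vertices \<open>vx k 7\<close> with \<open>k < n\<close>.
\<close>

definition link :: "nat \<Rightarrow> nat \<Rightarrow> nat \<Rightarrow> nat \<times> nat" where
  "link n l t =
    [(vx l 0, vx l 1), (vx l 1, vx l 2), (vx l 2, vx l 3), (vx l 3, vx l 4), (vx l 4, vx l 5),
     (vx l 5, vx l 0), (vx l 0, vx l 6), (vx l 3, vx l 6),
     (vx l 2, vx (ring_succ n l) 1), (vx l 5, vx (ring_succ n l) 4), (vx l 6, vx (hub n l) 7)] ! t"

definition necklace :: "nat \<Rightarrow> (nat, nat) multigraph" where
  "necklace n =
    \<lparr>verts = prod_encode ` ({..<3 * n} \<times> {..<7} \<union> {..<n} \<times> {7}),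
     edges = prod_encode ` ({..<3 * n} \<times> {..<11}),
     ends = (\<lambda>e. case prod_decode e of (l, t) \<Rightarrow> {#fst (link n l t), snd (link n l t)#})\<rparr>"

text \<open>The inverse of \<open>link\<close>: the edges at \<open>vx l j\<close>. Ring edges
  entering a bead carry the index of the preceding bead; in the last row \<open>l\<close> is a hub
  number.\<close>

definition star :: "nat \<Rightarrow> nat \<Rightarrow> nat \<Rightarrow> nat list" where
  "star n l j =
    [[ed l 0, ed l 5, ed l 6], [ed l 0, ed l 1, ed (ring_pred n l) 8], [ed l 1, ed l 2, ed l 8],
     [ed l 2, ed l 3, ed l 7], [ed l 3, ed l 4, ed (ring_pred n l) 9], [ed l 4, ed l 5, ed l 9],
     [ed l 6, ed l 7, ed l 10], [ed (2 * l) 10, ed (2 * l + 1) 10, ed (3 * n - 1 - l) 10]] ! j"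

lemmas link_simps = link_def[of _ _ 0, simplified] link_def[of _ _ 1, simplified]
  link_def[of _ _ 2, simplified] link_def[of _ _ 3, simplified] link_def[of _ _ 4, simplified]
  link_def[of _ _ 5, simplified] link_def[of _ _ 6, simplified] link_def[of _ _ 7, simplified]
  link_def[of _ _ 8, simplified] link_def[of _ _ 9, simplified] link_def[of _ _ 10, simplified]

lemmas star_simps = star_def[of _ _ 0, simplified] star_def[of _ _ 1, simplified]
  star_def[of _ _ 2, simplified] star_def[of _ _ 3, simplified] star_def[of _ _ 4, simplified]
  star_def[of _ _ 5, simplified] star_def[of _ _ 6, simplified] star_def[of _ _ 7, simplified]

lemma less_7_cases: "j < 7 \<Longrightarrow> j \<in> {0, Suc 0, 2, 3, 4, 5, 6::nat}"
  by simp presburger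

lemma less_11_cases: "t < 11 \<Longrightarrow> t \<in> {0, Suc 0, 2, 3, 4, 5, 6, 7, 8, 9, 10::nat}"
  by simp presburger

lemma ends_necklace: "ends (necklace n) (ed l t) = {#fst (link n l t), snd (link n l t)#}"
  by (simp add: necklace_def)

lemma ed_in_edges [simp]: "ed l t \<in> edges (necklace n) \<longleftrightarrow> l < 3 * n \<and> t < 11"
  by (auto simp: necklace_def)

lemma vx_in_verts: "vx l j \<in> verts (necklace n) \<longleftrightarrow> l < 3 * n \<and> j < 7 \<or> l < n \<and> j = 7"
  by (auto simp: necklace_def)

lemma edge_cases:
  assumes "e \<in> edges (necklace n)"
  obtains l t where "e = ed l t" "l < 3 * n" "t < 11"
  using assms by (auto simp: necklace_def)

lemma vert_cases:
  assumes "v \<in> verts (necklace n)"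
  obtains (bead) l j where "v = vx l j" "l < 3 * n" "j < 7" | (hub) k where "v = vx k 7" "k < n"
  using assms by (auto simp: necklace_def)

lemma ring_succ_less [simp]: "l < 3 * n \<Longrightarrow> ring_succ n l < 3 * n"
  and ring_pred_less [simp]: "l < 3 * n \<Longrightarrow> ring_pred n l < 3 * n"
  by (auto simp: ring_succ_def ring_pred_def)

lemma ring_succ_eq_iff: "l < 3 * n \<Longrightarrow> l' < 3 * n \<Longrightarrow> ring_succ n l = l' \<longleftrightarrow> l = ring_pred n l'"
  by (auto simp: ring_succ_def ring_pred_def)

lemma ring_succ_pred [simp]: "l < 3 * n \<Longrightarrow> ring_succ n (ring_pred n l) = l"
  and ring_pred_succ [simp]: "l < 3 * n \<Longrightarrow> ring_pred n (ring_succ n l) = l"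
  by (auto simp: ring_succ_def ring_pred_def)

lemma hub_less [simp]: "l < 3 * n \<Longrightarrow> hub n l < n"
  by (auto simp: hub_def)

lemma hub_eq_iff:
  "l < 3 * n \<Longrightarrow> k < n \<Longrightarrow> hub n l = k \<longleftrightarrow> l = 2 * k \<or> l = 2 * k + 1 \<or> l = 3 * n - 1 - k"
  by (auto simp: hub_def)

lemma finite_necklace: "finite_graph (necklace n)"
proof
  have "set_mset (ends (necklace n) e) \<subseteq> verts (necklace n)" "size (ends (necklace n) e) = 2"
    if e: "e \<in> edges (necklace n)" for e
  proof -
    from e obtain l t where *: "e = ed l t" "l < 3 * n" "t < 11" by (rule edge_cases)
    show "set_mset (ends (necklace n) e) \<subseteq> verts (necklace n)"
      using less_11_cases[OF *(3)] *(2) unfolding *(1)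
      by (auto simp: ends_necklace link_simps vx_in_verts)
    show "size (ends (necklace n) e) = 2" by (simp add: *(1) ends_necklace)
  qed
  then show "finite_multigraph (necklace n)"
    by (simp add: finite_multigraph_def) (simp add: necklace_def)
qed

text \<open>Certifies \<open>star\<close> against \<open>link\<close>, also showing that there are
  no loops. Every later degree computation becomes a check of three list entries.\<close>

lemma count_ends_necklace:
  assumes "l < 3 * n" "t < 11" "vx l' j \<in> verts (necklace n)"
  shows "count (ends (necklace n) (ed l t)) (vx l' j) = of_bool (ed l t \<in> set (star n l' j))"
proof -
  consider "l' < 3 * n" "j \<in> {0, Suc 0, 2, 3, 4, 5, 6}" | "l' < n" "j = 7"
    using assms(3) less_7_cases by (auto simp: vx_in_verts)
  then show ?thesis
  proof cases
    case 1
    then show ?thesis using less_11_cases[OF assms(2)] assms(1)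
      by (elim insertE emptyE)
        (simp_all add: ends_necklace link_simps star_simps ring_succ_eq_iff eq_commute[of l' l])
  next
    case 2
    then show ?thesis using less_11_cases[OF assms(2)] assms(1)
      by (elim insertE emptyE) (simp_all add: ends_necklace link_simps star_simps hub_eq_iff)
  qed
qed

lemma star_subset: "vx l j \<in> verts (necklace n) \<Longrightarrow> set (star n l j) \<subseteq> edges (necklace n)"
  using less_7_cases[of j] by (auto simp: vx_in_verts star_simps)

lemma distinct_star: "vx l j \<in> verts (necklace n) \<Longrightarrow> distinct (star n l j)"
  using less_7_cases[of j] by (auto simp: vx_in_verts star_simps)

lemma length_star: "vx l j \<in> verts (necklace n) \<Longrightarrow> length (star n l j) = 3"
  using less_7_cases[of j] by (auto simp: vx_in_verts star_simps)

lemma card_Int_set: "distinct xs \<Longrightarrow> card (F \<inter> set xs) = (\<Sum>x\<leftarrow>xs. of_bool (x \<in> F))"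
  by (induction xs) (auto simp: Int_insert_right)

lemma edge_degree_necklace:
  assumes "F \<subseteq> edges (necklace n)" "vx l j \<in> verts (necklace n)"
  shows "edge_degree (necklace n) F (vx l j) = (\<Sum>e\<leftarrow>star n l j. of_bool (e \<in> F))"
proof -
  interpret finite_graph "necklace n" by (rule finite_necklace)
  have "edge_degree (necklace n) F (vx l j) = (\<Sum>e\<in>F. of_bool (e \<in> set (star n l j)))"
    unfolding edge_degree_def
  proof (rule sum.cong)
    fix e assume "e \<in> F"
    then have "e \<in> edges (necklace n)" using assms by auto
    then show "count (ends (necklace n) e) (vx l j) = of_bool (e \<in> set (star n l j))"
      using count_ends_necklace[OF _ _ assms(2)] by (auto elim: edge_cases)
  qed simp
  also have "\<dots> = card (F \<inter> set (star n l j))"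
    using finite_edge_subset[OF assms(1)] by (simp add: Int_def)
  finally show ?thesis using card_Int_set[OF distinct_star[OF assms(2)]] by simp
qed

lemma cubic_necklace: "cubic (necklace n)"
  unfolding cubic_def regular_def
proof
  fix v assume v: "v \<in> verts (necklace n)"
  then obtain l j where v_eq: "v = vx l j" by (auto elim: vert_cases)
  have "degree (necklace n) v = (\<Sum>e\<leftarrow>star n l j. of_bool (e \<in> edges (necklace n)))"
    using edge_degree_necklace[OF subset_refl] v unfolding v_eq degree_def edge_degree_def by simp
  also have "\<dots> = (\<Sum>e\<leftarrow>star n l j. 1)"
    using star_subset[of l j n] v unfolding v_eq by (intro arg_cong[where f = sum_list] map_cong) auto
  finally show "degree (necklace n) v = 3"
    using length_star[of l j n] v by (simp add: v_eq sum_list_triv)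
qed

lemma card_verts_necklace: "card (verts (necklace n)) = 22 * n"
proof -
  have "card (verts (necklace n)) = card ({..<3 * n} \<times> {..<7::nat} \<union> {..<n} \<times> {7})"
    unfolding necklace_def by (simp add: card_image inj_prod_encode)
  also have "\<dots> = 22 * n" by (subst card_Un_disjoint) (auto simp: card_cartesian_product)
  finally show ?thesis .
qed

section \<open>Colouring defect\<close>

text \<open>Labels 11 and 12 stand for the ring edges that enter the bead at its vertices 1 and 4.
  The claim is finite and is settled propositionally.\<close>

lemma theta_colouring:
  fixes c :: "nat \<Rightarrow> nat"
  assumes c: "\<And>t. c t < 3"
    and v: "distinct [c 0, c 5, c 6]" "distinct [c 0, c 1, c 11]" "distinct [c 1, c 2, c 8]"
      "distinct [c 2, c 3, c 7]" "distinct [c 3, c 4, c 12]" "distinct [c 4, c 5, c 9]"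
      "distinct [c 6, c 7, c 10]"
  shows "c 8 = c 9 \<longleftrightarrow> c 11 \<noteq> c 12"
proof -
  \<comment> \<open>Two bits per edge code its colour; \<open>excl\<close> below excludes the fourth
    bit pattern.\<close>
  define p q where "p t = (c t = 0)" and "q t = (c t = 1)" for t
  have eq: "c s = c t \<longleftrightarrow> (p s \<longleftrightarrow> p t) \<and> (q s \<longleftrightarrow> q t)" for s t
    using c[of s] c[of t] unfolding p_def q_def by linarith
  have "\<not> (p t \<and> q t)" for t by (auto simp: p_def q_def)
  note excl = this[of 0] this[of 1] this[of 2] this[of 3] this[of 4] this[of 5] this[of 6] this[of 7]
    this[of 8] this[of 9] this[of 10] this[of 11] this[of 12]
  have dist: "distinct [a, b, d] \<longleftrightarrow> a \<noteq> b \<and> a \<noteq> d \<and> b \<noteq> d" for a b d :: nat by auto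
  show ?thesis using v excl unfolding dist eq by sat
qed

lemma perfect_matching_star:
  assumes "perfect_matching (necklace n) M" "vx l j \<in> verts (necklace n)"
  shows "(\<Sum>e\<leftarrow>star n l j. of_bool (e \<in> M)) = (1::nat)"
  using assms edge_degree_necklace[of M n l j] by (simp add: perfect_matching_iff)

text \<open>A bead lies in the arc exactly if its hub is among the first \<open>k\<close>, so no hub
  edge crosses and only the ring edges at the two ends of the arc remain. The size of
  \<open>X\<close> matters because it is even.\<close>

lemma cut_necklace:
  assumes "1 \<le> k" "k < n"
  defines "X \<equiv> {vx l j |l j. (l < 2 * k \<or> 3 * n - k \<le> l \<and> l < 3 * n) \<and> j < 7} \<union> {vx i 7 |i. i < k}"
  shows "edge_cut (necklace n) X =
    {ed (2 * k - 1) 8, ed (2 * k - 1) 9, ed (3 * n - 1 - k) 8, ed (3 * n - 1 - k) 9}"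
    and "X \<subseteq> verts (necklace n)" and "card X = 22 * k"
proof -
  define P where "P l \<longleftrightarrow> l < 2 * k \<or> 3 * n - k \<le> l \<and> l < 3 * n" for l
  have X: "vx l j \<in> X \<longleftrightarrow> P l \<and> j < 7 \<or> l < k \<and> j = 7" for l j
    by (auto simp: X_def P_def)
  have hub: "hub n l < k \<longleftrightarrow> P l" if "l < 3 * n" for l
    using that assms(1,2) by (auto simp: hub_def P_def)
  have succ: "P (ring_succ n l) \<noteq> P l \<longleftrightarrow> l = 2 * k - 1 \<or> l = 3 * n - 1 - k" if "l < 3 * n" for l
    using that assms(1,2) by (auto simp: ring_succ_def P_def)
  have cut: "ed l t \<in> edge_cut (necklace n) X \<longleftrightarrow>
      (l = 2 * k - 1 \<or> l = 3 * n - 1 - k) \<and> (t = 8 \<or> t = 9)" if l: "l < 3 * n" "t < 11" for l t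
    using less_11_cases[OF l(2)] l(1) hub[OF l(1)] succ[OF l(1)]
    by (elim insertE emptyE) (auto simp: edge_cut_def ends_necklace link_simps X)
  show "edge_cut (necklace n) X =
      {ed (2 * k - 1) 8, ed (2 * k - 1) 9, ed (3 * n - 1 - k) 8, ed (3 * n - 1 - k) 9}"
  proof (intro set_eqI iffI)
    fix e assume e: "e \<in> edge_cut (necklace n) X"
    then have "e \<in> edges (necklace n)" by (simp add: edge_cut_def)
    then obtain l t where "e = ed l t" "l < 3 * n" "t < 11" by (rule edge_cases)
    then show "e \<in> {ed (2 * k - 1) 8, ed (2 * k - 1) 9, ed (3 * n - 1 - k) 8, ed (3 * n - 1 - k) 9}"
      using cut e by auto
  next
    fix e assume "e \<in> {ed (2 * k - 1) 8, ed (2 * k - 1) 9, ed (3 * n - 1 - k) 8, ed (3 * n - 1 - k) 9}"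
    moreover have "2 * k - 1 < 3 * n" "3 * n - 1 - k < 3 * n" using assms(1,2) by auto
    ultimately show "e \<in> edge_cut (necklace n) X" using cut by auto
  qed
  show "X \<subseteq> verts (necklace n)" using assms(1,2) by (auto simp: X_def vx_in_verts)
  have "X = prod_encode ` (({..<2 * k} \<union> {3 * n - k..<3 * n}) \<times> {..<7} \<union> {..<k} \<times> {7})"
    by (auto simp: X_def image_iff)
  then have "card X = card (({..<2 * k} \<union> {3 * n - k..<3 * n}) \<times> {..<7::nat} \<union> {..<k} \<times> {7})"
    by (simp add: card_image inj_prod_encode)
  also have "\<dots> = card ({..<2 * k} \<union> {3 * n - k..<3 * n}) * 7 + k"
    by (subst card_Un_disjoint) (auto simp: card_cartesian_product)
  also have "card ({..<2 * k} \<union> {3 * n - k..<3 * n}) = 3 * k"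
    using assms(1,2) by (subst card_Un_disjoint) auto
  finally show "card X = 22 * k" by simp
qed

text \<open>Four entries with even colour classes are all equal or form two equal pairs.\<close>

lemma even_colour_classes_4:
  fixes a b c d :: nat
  assumes "a < 3" "b < 3" "c < 3" "d < 3"
    and "\<And>i. i < 3 \<Longrightarrow> even (of_bool (a = i) + of_bool (b = i) + of_bool (c = i) + of_bool (d = i) :: nat)"
  shows "a = b \<longleftrightarrow> c = d"
proof -
  have cases: "x = 0 \<or> x = 1 \<or> x = 2" if "x < 3" for x :: nat using that by arith
  show ?thesis
    using assms(5)[of 0] assms(5)[of 1] assms(5)[of 2] cases[OF assms(1)] cases[OF assms(2)]
      cases[OF assms(3)] cases[OF assms(4)]
    by (elim disjE) simp_all
qed

section \<open>Three perfect matchings read as a colouring near one hub\<close>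

locale three_matchings =
  fixes n :: nat and M1 M2 M3 :: "nat set"
  assumes pm1: "perfect_matching (necklace n) M1"
    and pm2: "perfect_matching (necklace n) M2"
    and pm3: "perfect_matching (necklace n) M3"
begin

text \<open>An edge in several matchings gets the first, an uncovered edge gets 2 by default; the
  value is faithful only for edges that are \<open>simple\<close>.\<close>

definition colour :: "nat \<Rightarrow> nat" where
  "colour e = (if e \<in> M1 then 0 else if e \<in> M2 then 1 else 2)"

text \<open>Amounts to lying in exactly one of the three matchings: an uncovered edge fails, since
  its default colour 2 claims membership in \<open>M3\<close>.\<close>

definition simple :: "nat \<Rightarrow> bool" where
  "simple e \<longleftrightarrow> (e \<in> M1 \<longleftrightarrow> colour e = 0) \<and> (e \<in> M2 \<longleftrightarrow> colour e = 1) \<and> (e \<in> M3 \<longleftrightarrow> colour e = 2)"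

lemma colour_less: "colour e < 3"
  by (simp add: colour_def)

text \<open>Three matchings meet the vertex once each; if they cover all three edges there, they do
  so bijectively.\<close>

lemma covered_vertex:
  assumes v: "vx l j \<in> verts (necklace n)" and cov: "set (star n l j) \<subseteq> M1 \<union> M2 \<union> M3"
  shows "distinct (map colour (star n l j))" "\<forall>e\<in>set (star n l j). simple e"
proof -
  obtain a b c where abc: "star n l j = [a, b, c]"
    using length_star[OF v] by (auto simp: length_Suc_conv numeral_3_eq_3)
  have M: "a \<in> M \<and> b \<notin> M \<and> c \<notin> M \<or> a \<notin> M \<and> b \<in> M \<and> c \<notin> M \<or> a \<notin> M \<and> b \<notin> M \<and> c \<in> M"
    if "perfect_matching (necklace n) M" for M
    using perfect_matching_star[OF that v] by (simp add: abc of_bool_def split: if_splits)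
  show "distinct (map colour (star n l j))" "\<forall>e\<in>set (star n l j). simple e"
    using M[OF pm1] M[OF pm2] M[OF pm3] cov by (auto simp: abc colour_def simple_def)
qed

lemma bead_colouring:
  assumes l: "l < 3 * n" and cov: "\<And>j. j < 7 \<Longrightarrow> set (star n l j) \<subseteq> M1 \<union> M2 \<union> M3"
  defines "p \<equiv> ring_pred n l"
  shows "colour (ed l 8) = colour (ed l 9) \<longleftrightarrow> colour (ed p 8) \<noteq> colour (ed p 9)"
proof -
  define c where "c t = (if t = 11 then colour (ed p 8) else if t = 12 then colour (ed p 9)
    else colour (ed l t))" for t
  have "c 8 = c 9 \<longleftrightarrow> c 11 \<noteq> c 12"
  proof (rule theta_colouring)
    have v: "vx l j \<in> verts (necklace n)" if "j < 7" for j using l that by (simp add: vx_in_verts)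
    note d = covered_vertex(1)[OF v cov]
    show "distinct [c 0, c 5, c 6]" using d[of 0] by (simp add: star_simps c_def)
    show "distinct [c 0, c 1, c 11]" using d[of 1] by (simp add: star_simps c_def p_def)
    show "distinct [c 1, c 2, c 8]" using d[of 2] by (simp add: star_simps c_def)
    show "distinct [c 2, c 3, c 7]" using d[of 3] by (simp add: star_simps c_def)
    show "distinct [c 3, c 4, c 12]" using d[of 4] by (simp add: star_simps c_def p_def)
    show "distinct [c 4, c 5, c 9]" using d[of 5] by (simp add: star_simps c_def)
    show "distinct [c 6, c 7, c 10]" using d[of 6] by (simp add: star_simps c_def)
  qed (simp add: c_def colour_less)
  then show ?thesis by (simp add: c_def)
qed

text \<open>On these \<open>simple\<close> edges the colour classes are the traces of the matchings
  on the cut, and these are even. Parity holds however the matchings behave elsewhere, so the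
  argument stays local to one hub.\<close>

lemma cut_colouring:
  assumes k: "1 \<le> k" "k < n"
    and s: "simple (ed (2 * k - 1) 8)" "simple (ed (2 * k - 1) 9)"
      "simple (ed (3 * n - 1 - k) 8)" "simple (ed (3 * n - 1 - k) 9)"
  shows "colour (ed (2 * k - 1) 8) = colour (ed (2 * k - 1) 9) \<longleftrightarrow>
    colour (ed (3 * n - 1 - k) 8) = colour (ed (3 * n - 1 - k) 9)"
proof (rule even_colour_classes_4)
  interpret finite_graph "necklace n" by (rule finite_necklace)
  let ?es = "[ed (2 * k - 1) 8, ed (2 * k - 1) 9, ed (3 * n - 1 - k) 8, ed (3 * n - 1 - k) 9]"
  have dist: "distinct ?es" using k by auto
  have even: "even (\<Sum>e\<leftarrow>?es. of_bool (e \<in> M) :: nat)" if M: "perfect_matching (necklace n) M" for M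
  proof -
    have "even (card (M \<inter> set ?es))"
      using perfect_matching_cut_parity[OF M cut_necklace(2)[OF k]] cut_necklace(1,3)[OF k] by simp
    then show ?thesis unfolding card_Int_set[OF dist] .
  qed
  fix i :: nat assume "i < 3"
  then consider "i = 0" | "i = 1" | "i = 2" by linarith
  then show "even (of_bool (colour (ed (2 * k - 1) 8) = i) + of_bool (colour (ed (2 * k - 1) 9) = i)
    + of_bool (colour (ed (3 * n - 1 - k) 8) = i) + of_bool (colour (ed (3 * n - 1 - k) 9) = i) :: nat)"
    using even[OF pm1] even[OF pm2] even[OF pm3] s unfolding simple_def by cases (simp_all add: add.assoc)
qed (rule colour_less)+

text \<open>If all edges at the beads of hub \<open>k\<close> were covered, monochromaticity would
  flip twice along beads \<open>2 * k\<close> and \<open>2 * k + 1\<close> but once along bead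
  \<open>3 * n - 1 - k\<close>, while the two cuts force the same change on both sides.\<close>

lemma uncovered_edge_in_block:
  assumes k: "k < n"
  shows "\<exists>l t. ed l t \<in> edges (necklace n) - (M1 \<union> M2 \<union> M3)
    \<and> (hub n l = k \<or> hub n (ring_succ n l) = k)"
proof (rule ccontr)
  assume neg: "\<not> ?thesis"
  have cov: "ed l t \<in> M1 \<union> M2 \<union> M3"
    if "l < 3 * n" "t < 11" "hub n l = k \<or> hub n (ring_succ n l) = k" for l t
    using neg that by force
  \<comment> \<open>Vertices 1 and 4 of a bead lie on edges indexed by the preceding bead, which may
    serve another hub; hence the alternative with \<open>ring_succ\<close> in the claim.\<close>
  have star: "set (star n l j) \<subseteq> M1 \<union> M2 \<union> M3" if l: "l < 3 * n" "hub n l = k" and j: "j < 7" for l j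
    using less_7_cases[OF j] cov[OF l(1)] cov[of "ring_pred n l"] l
    by (elim insertE emptyE) (simp_all add: star_simps)
  let ?same = "\<lambda>l. colour (ed l 8) = colour (ed l 9)"
  have flip: "?same l \<longleftrightarrow> \<not> ?same (ring_pred n l)" if "l < 3 * n" "hub n l = k" for l
    using bead_colouring star that by blast
  have simple: "simple (ed l 8)" "simple (ed l 9)" "simple (ed (ring_pred n l) 8)"
    "simple (ed (ring_pred n l) 9)" if l: "l < 3 * n" "hub n l = k" for l
    using covered_vertex(2)[of l 1, OF _ star[OF l]] covered_vertex(2)[of l 2, OF _ star[OF l]]
      covered_vertex(2)[of l 4, OF _ star[OF l]] covered_vertex(2)[of l 5, OF _ star[OF l]] l
    by (simp_all add: star_simps vx_in_verts)
  have l: "2 * k < 3 * n" "2 * k + 1 < 3 * n" "3 * n - 1 - k < 3 * n" using k by auto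
  have h: "hub n (2 * k) = k" "hub n (2 * k + 1) = k" "hub n (3 * n - 1 - k) = k"
    using k by (auto simp: hub_def)
  note flips = flip[OF l(1) h(1)] flip[OF l(2) h(2)] flip[OF l(3) h(3)]
  note simples = simple[OF l(1) h(1)] simple[OF l(2) h(2)] simple[OF l(3) h(3)]
  have "?same (ring_pred n (2 * k)) \<longleftrightarrow> ?same (3 * n - 1 - k)"
  proof (cases "k = 0")
    case False
    then have "ring_pred n (2 * k) = 2 * k - 1" by (simp add: ring_pred_def)
    then show ?thesis using cut_colouring[of k] False k simples by simp
  qed (simp add: ring_pred_def)
  moreover have "?same (2 * k + 1) \<longleftrightarrow> ?same (ring_pred n (3 * n - 1 - k))"
  proof (cases "Suc k = n")
    case False
    then have "ring_pred n (3 * n - 1 - k) = 3 * n - 1 - Suc k" using k by (simp add: ring_pred_def)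
    then show ?thesis using cut_colouring[of "Suc k"] False k simples by simp
  next
    case True
    then have "ring_pred n (3 * n - 1 - k) = 2 * k + 1" by (auto simp: ring_pred_def)
    then show ?thesis by simp
  qed
  moreover have "ring_pred n (2 * k + 1) = 2 * k" by (simp add: ring_pred_def)
  ultimately show False using flips by auto
qed

text \<open>Each uncovered edge is charged to at most two hubs: those of its own bead and of the
  next one.\<close>

lemma card_uncovered: "n \<le> 2 * card (edges (necklace n) - (M1 \<union> M2 \<union> M3))"
proof -
  interpret finite_graph "necklace n" by (rule finite_necklace)
  let ?U = "edges (necklace n) - (M1 \<union> M2 \<union> M3)"
  let ?f = "\<lambda>e. hub n (fst (prod_decode e))"
  let ?g = "\<lambda>e. hub n (ring_succ n (fst (prod_decode e)))"
  have "{..<n} \<subseteq> ?f ` ?U \<union> ?g ` ?U"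
  proof
    fix k assume "k \<in> {..<n}"
    then obtain l t where lt: "ed l t \<in> ?U" "hub n l = k \<or> hub n (ring_succ n l) = k"
      using uncovered_edge_in_block by blast
    then have "k = ?f (ed l t) \<or> k = ?g (ed l t)" by auto
    then show "k \<in> ?f ` ?U \<union> ?g ` ?U" using lt(1) by blast
  qed
  then have "card {..<n} \<le> card (?f ` ?U \<union> ?g ` ?U)" by (intro card_mono) auto
  also have "\<dots> \<le> card (?f ` ?U) + card (?g ` ?U)" by (rule card_Un_le)
  also have "\<dots> \<le> card ?U + card ?U" by (intro add_mono card_image_le) auto
  finally show ?thesis by simp
qed

end

section \<open>Girth and connectivity\<close>

text \<open>Degrees on a circuit are 0 or 2: a circuit that enters a vertex must leave it by another
  edge.\<close>

lemma circuit_star: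
  assumes C: "circuit (necklace n) C" and v: "vx l j \<in> verts (necklace n)"
    and star: "star n l j = [a, b, c]"
  shows "(a \<in> C \<longrightarrow> b \<in> C \<or> c \<in> C) \<and> (b \<in> C \<longrightarrow> a \<in> C \<or> c \<in> C) \<and> (c \<in> C \<longrightarrow> a \<in> C \<or> b \<in> C)"
proof -
  interpret finite_graph "necklace n" by (rule finite_necklace)
  have "C \<subseteq> edges (necklace n)" using C by (simp add: circuit_iff)
  from edge_degree_necklace[OF this v] show ?thesis
    using circuit_degree_cases[OF C, of "vx l j"]
    by (cases "a \<in> C"; cases "b \<in> C"; cases "c \<in> C") (simp_all add: star)
qed

lemma circuit_bead:
  assumes C: "circuit (necklace n) C" and l: "l < 3 * n"
  defines "p \<equiv> ring_pred n l"
  shows "ed l 0 \<in> C \<Longrightarrow> ed l 5 \<in> C \<or> ed l 6 \<in> C" "ed l 5 \<in> C \<Longrightarrow> ed l 0 \<in> C \<or> ed l 6 \<in> C"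
    "ed l 6 \<in> C \<Longrightarrow> ed l 0 \<in> C \<or> ed l 5 \<in> C"
    "ed l 0 \<in> C \<Longrightarrow> ed l 1 \<in> C \<or> ed p 8 \<in> C" "ed l 1 \<in> C \<Longrightarrow> ed l 0 \<in> C \<or> ed p 8 \<in> C"
    "ed p 8 \<in> C \<Longrightarrow> ed l 0 \<in> C \<or> ed l 1 \<in> C"
    "ed l 1 \<in> C \<Longrightarrow> ed l 2 \<in> C \<or> ed l 8 \<in> C" "ed l 2 \<in> C \<Longrightarrow> ed l 1 \<in> C \<or> ed l 8 \<in> C"
    "ed l 8 \<in> C \<Longrightarrow> ed l 1 \<in> C \<or> ed l 2 \<in> C"
    "ed l 2 \<in> C \<Longrightarrow> ed l 3 \<in> C \<or> ed l 7 \<in> C" "ed l 3 \<in> C \<Longrightarrow> ed l 2 \<in> C \<or> ed l 7 \<in> C"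
    "ed l 7 \<in> C \<Longrightarrow> ed l 2 \<in> C \<or> ed l 3 \<in> C"
    "ed l 3 \<in> C \<Longrightarrow> ed l 4 \<in> C \<or> ed p 9 \<in> C" "ed l 4 \<in> C \<Longrightarrow> ed l 3 \<in> C \<or> ed p 9 \<in> C"
    "ed p 9 \<in> C \<Longrightarrow> ed l 3 \<in> C \<or> ed l 4 \<in> C"
    "ed l 4 \<in> C \<Longrightarrow> ed l 5 \<in> C \<or> ed l 9 \<in> C" "ed l 5 \<in> C \<Longrightarrow> ed l 4 \<in> C \<or> ed l 9 \<in> C"
    "ed l 9 \<in> C \<Longrightarrow> ed l 4 \<in> C \<or> ed l 5 \<in> C"
    "ed l 6 \<in> C \<Longrightarrow> ed l 7 \<in> C \<or> ed l 10 \<in> C" "ed l 7 \<in> C \<Longrightarrow> ed l 6 \<in> C \<or> ed l 10 \<in> C"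
    "ed l 10 \<in> C \<Longrightarrow> ed l 6 \<in> C \<or> ed l 7 \<in> C"
proof -
  have v: "vx l j \<in> verts (necklace n)" if "j < 7" for j using l that by (simp add: vx_in_verts)
  note s = circuit_star[OF C v]
  show "ed l 0 \<in> C \<Longrightarrow> ed l 5 \<in> C \<or> ed l 6 \<in> C" "ed l 5 \<in> C \<Longrightarrow> ed l 0 \<in> C \<or> ed l 6 \<in> C"
    "ed l 6 \<in> C \<Longrightarrow> ed l 0 \<in> C \<or> ed l 5 \<in> C"
    using s[OF _ star_simps(1)] by simp_all
  show "ed l 0 \<in> C \<Longrightarrow> ed l 1 \<in> C \<or> ed p 8 \<in> C" "ed l 1 \<in> C \<Longrightarrow> ed l 0 \<in> C \<or> ed p 8 \<in> C"
    "ed p 8 \<in> C \<Longrightarrow> ed l 0 \<in> C \<or> ed l 1 \<in> C"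
    using s[OF _ star_simps(2)] unfolding p_def by simp_all
  show "ed l 1 \<in> C \<Longrightarrow> ed l 2 \<in> C \<or> ed l 8 \<in> C" "ed l 2 \<in> C \<Longrightarrow> ed l 1 \<in> C \<or> ed l 8 \<in> C"
    "ed l 8 \<in> C \<Longrightarrow> ed l 1 \<in> C \<or> ed l 2 \<in> C"
    using s[OF _ star_simps(3)] by simp_all
  show "ed l 2 \<in> C \<Longrightarrow> ed l 3 \<in> C \<or> ed l 7 \<in> C" "ed l 3 \<in> C \<Longrightarrow> ed l 2 \<in> C \<or> ed l 7 \<in> C"
    "ed l 7 \<in> C \<Longrightarrow> ed l 2 \<in> C \<or> ed l 3 \<in> C"
    using s[OF _ star_simps(4)] by simp_all
  show "ed l 3 \<in> C \<Longrightarrow> ed l 4 \<in> C \<or> ed p 9 \<in> C" "ed l 4 \<in> C \<Longrightarrow> ed l 3 \<in> C \<or> ed p 9 \<in> C"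
    "ed p 9 \<in> C \<Longrightarrow> ed l 3 \<in> C \<or> ed l 4 \<in> C"
    using s[OF _ star_simps(5)] unfolding p_def by simp_all
  show "ed l 4 \<in> C \<Longrightarrow> ed l 5 \<in> C \<or> ed l 9 \<in> C" "ed l 5 \<in> C \<Longrightarrow> ed l 4 \<in> C \<or> ed l 9 \<in> C"
    "ed l 9 \<in> C \<Longrightarrow> ed l 4 \<in> C \<or> ed l 5 \<in> C"
    using s[OF _ star_simps(6)] by simp_all
  show "ed l 6 \<in> C \<Longrightarrow> ed l 7 \<in> C \<or> ed l 10 \<in> C" "ed l 7 \<in> C \<Longrightarrow> ed l 6 \<in> C \<or> ed l 10 \<in> C"
    "ed l 10 \<in> C \<Longrightarrow> ed l 6 \<in> C \<or> ed l 7 \<in> C"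
    using s[OF _ star_simps(7)] by simp_all
qed

text \<open>A bead is a theta graph: three paths join \<open>vx l 0\<close> to
  \<open>vx l 3\<close>. A circuit that stays inside contains each path entirely or not at all, and
  at \<open>vx l 0\<close> it uses two of them.\<close>

lemma circuit_in_bead:
  assumes C: "circuit (necklace n) C" and l: "l < 3 * n" and t: "ed l t \<in> C" "t < 8"
    and no: "ed l 8 \<notin> C" "ed l 9 \<notin> C" "ed l 10 \<notin> C" "ed (ring_pred n l) 8 \<notin> C" "ed (ring_pred n l) 9 \<notin> C"
  shows "{ed l 0, ed l 1, ed l 2, ed l 6, ed l 7} \<subseteq> C \<or> {ed l 3, ed l 4, ed l 5, ed l 6, ed l 7} \<subseteq> C
    \<or> {ed l 0, ed l 1, ed l 2, ed l 3, ed l 4, ed l 5} \<subseteq> C"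
proof -
  note b = circuit_bead[OF C l]
  have "t \<in> {0, 1, 2, 3, 4, 5, 6, 7}" using t(2) by simp presburger
  then have "ed l 0 \<in> C \<or> ed l 1 \<in> C \<or> ed l 2 \<in> C \<or> ed l 3 \<in> C \<or> ed l 4 \<in> C \<or> ed l 5 \<in> C
    \<or> ed l 6 \<in> C \<or> ed l 7 \<in> C" using t(1) by auto
  moreover have "ed l 1 \<in> C \<longleftrightarrow> ed l 0 \<in> C" using b(4,5) no(4) by blast
  moreover have "ed l 2 \<in> C \<longleftrightarrow> ed l 1 \<in> C" using b(7,8) no(1) by blast
  moreover have "ed l 4 \<in> C \<longleftrightarrow> ed l 3 \<in> C" using b(13,14) no(5) by blast
  moreover have "ed l 5 \<in> C \<longleftrightarrow> ed l 4 \<in> C" using b(16,17) no(2) by blast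
  moreover have "ed l 7 \<in> C \<longleftrightarrow> ed l 6 \<in> C" using b(19,20) no(3) by blast
  ultimately show ?thesis using b(1,2,3) by simp blast
qed

lemma five_le_card:
  assumes "distinct [a, b, c, d, e]" "set [a, b, c, d, e] \<subseteq> C" "finite C"
  shows "5 \<le> card C"
  using card_mono[OF assms(3,2)] distinct_card[OF assms(1)] by simp

text \<open>Either the circuit stays in one bead, or it is traced from a hub edge or a ring edge
  until five distinct edges are found.\<close>

lemma circuit_card_ge_5:
  assumes C: "circuit (necklace n) C" and n: "0 < n"
  shows "5 \<le> card C"
proof -
  interpret finite_graph "necklace n" by (rule finite_necklace)
  have CE: "C \<subseteq> edges (necklace n)" using C by (simp add: circuit_iff)
  then have fC: "finite C" by (rule finite_edge_subset)
  note five = five_le_card[OF _ _ fC]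
  note b = circuit_bead[OF C]
  \<comment> \<open>With at least three beads the two neighbours of a bead differ, which keeps the
    edges found on the two sides of a ring edge apart.\<close>
  have ring: "ring_pred n l \<noteq> l" "ring_succ n l \<noteq> l" "ring_pred n l \<noteq> ring_succ n l" if "l < 3 * n" for l
    using that n unfolding ring_pred_def ring_succ_def by presburger+
  consider (hub) l where "l < 3 * n" "ed l 10 \<in> C"
    | (upper) l where "l < 3 * n" "ed l 8 \<in> C" | (lower) l where "l < 3 * n" "ed l 9 \<in> C"
    | (bead) "\<And>l. l < 3 * n \<Longrightarrow> ed l 8 \<notin> C" "\<And>l. l < 3 * n \<Longrightarrow> ed l 9 \<notin> C" "\<And>l. l < 3 * n \<Longrightarrow> ed l 10 \<notin> C"
    by blast
  then show ?thesis
  proof cases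
    case hub
    define k where "k = hub n l"
    have k: "k < n" using hub by (simp add: k_def)
    then have "vx k 7 \<in> verts (necklace n)" by (simp add: vx_in_verts)
    from circuit_star[OF C this star_simps(8)]
    have s: "ed (2 * k) 10 \<in> C \<Longrightarrow> ed (2 * k + 1) 10 \<in> C \<or> ed (3 * n - 1 - k) 10 \<in> C"
      "ed (2 * k + 1) 10 \<in> C \<Longrightarrow> ed (2 * k) 10 \<in> C \<or> ed (3 * n - 1 - k) 10 \<in> C"
      "ed (3 * n - 1 - k) 10 \<in> C \<Longrightarrow> ed (2 * k) 10 \<in> C \<or> ed (2 * k + 1) 10 \<in> C"
      by simp_all
    have less: "2 * k < 3 * n" "2 * k + 1 < 3 * n" "3 * n - 1 - k < 3 * n" using k by auto
    have ne: "2 * k + 1 \<noteq> 2 * k" "3 * n - 1 - k \<noteq> 2 * k" "3 * n - 1 - k \<noteq> 2 * k + 1" using k by auto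
    have "l = 2 * k \<or> l = 2 * k + 1 \<or> l = 3 * n - 1 - k"
      using hub_eq_iff[OF hub(1) k] k_def by simp
    then have "\<exists>l'. l' \<noteq> l \<and> l' < 3 * n \<and> ed l' 10 \<in> C"
      using hub(2)
    proof (elim disjE)
      show ?thesis if "l = 2 * k" "ed l 10 \<in> C"
        using s(1) that less(2,3) ne(1,2) by blast
      show ?thesis if "l = 2 * k + 1" "ed l 10 \<in> C"
        using s(2) that less(1,3) ne(1,3) by metis
      show ?thesis if "l = 3 * n - 1 - k" "ed l 10 \<in> C"
        using s(3) that less(1,2) ne(2,3) by metis
    qed
    then obtain l' where l': "l' \<noteq> l" "l' < 3 * n" "ed l' 10 \<in> C" by blast
    \<comment> \<open>Two hub edges and one edge next to each make four; the fifth continues past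
      \<open>vx l 0\<close> or \<open>vx l 3\<close>.\<close>
    obtain x y where "x \<in> {6, 7}" "ed l x \<in> C" "y \<in> {0, 5, 2, 3}" "ed l y \<in> C"
      using b(21)[OF hub] b(3)[OF hub(1)] b(12)[OF hub(1)] by blast
    moreover obtain x' where "x' \<in> {6, 7}" "ed l' x' \<in> C" using b(21)[OF l'(2,3)] by blast
    ultimately show ?thesis
      using l' hub by (intro five[of "ed l 10" "ed l' 10" "ed l x" "ed l' x'" "ed l y"]) auto
  next
    case upper
    let ?l = "ring_succ n l"
    note p = ring_pred_succ[OF upper(1)]
    note bl = b[OF upper(1)] and br = b[OF ring_succ_less[OF upper(1)], unfolded p]
    \<comment> \<open>Two edges on each side of the ring edge: \<open>x\<close> and \<open>f\<close>
      backwards, \<open>y\<close> and \<open>g\<close> forwards.\<close>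
    obtain x where x: "x \<in> {1, 2}" "ed l x \<in> C" using bl(9)[OF upper(2)] by blast
    then obtain f where f: "f \<in> {ed l 0, ed (ring_pred n l) 8, ed l 3, ed l 7}" "f \<in> C"
      using bl(5) bl(10) by blast
    then have f': "f \<notin> {ed l 8, ed l 1, ed l 2}" "fst (prod_decode f) \<noteq> ?l"
      using ring[OF upper(1)] by auto
    obtain y where y: "y \<in> {0, 1}" "ed ?l y \<in> C" using br(6)[OF upper(2)] by blast
    then obtain g where g: "g \<in> {ed ?l 5, ed ?l 6, ed ?l 2, ed ?l 8}" "g \<in> C"
      using br(1) br(7) by blast
    then have g': "g \<notin> {ed ?l 0, ed ?l 1}" "fst (prod_decode g) = ?l" by auto
    have "ed l 8 \<noteq> ed l x" "f \<noteq> ed l x" using x(1) f'(1) by auto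
    moreover have "g \<noteq> ed ?l y" using y(1) g'(1) by auto
    moreover have "ed l x \<noteq> ed ?l y" "ed l 8 \<noteq> ed ?l y" using ring(2)[OF upper(1)] by simp_all
    moreover have "f \<noteq> ed ?l y" using f'(2) by (metis prod_encode_inverse fst_conv)
    moreover have "g \<noteq> ed l x" "g \<noteq> ed l 8"
      using g'(2) ring(2)[OF upper(1)] by (metis prod_encode_inverse fst_conv)+
    moreover have "g \<noteq> f" using f'(2) g'(2) by metis
    moreover have "f \<noteq> ed l 8" using f'(1) by simp
    ultimately show ?thesis
      using x(2) y(2) f(2) g(2) upper(2)
      by (intro five[of g f "ed l 8" "ed l x" "ed ?l y"]) simp_all
  next
    case lower
    let ?l = "ring_succ n l"
    note p = ring_pred_succ[OF lower(1)]
    note bl = b[OF lower(1)] and br = b[OF ring_succ_less[OF lower(1)], unfolded p]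
    obtain x where x: "x \<in> {4, 5}" "ed l x \<in> C" using bl(18)[OF lower(2)] by blast
    then obtain f where f: "f \<in> {ed l 3, ed (ring_pred n l) 9, ed l 0, ed l 6}" "f \<in> C"
      using bl(14) bl(2) by blast
    then have f': "f \<notin> {ed l 9, ed l 4, ed l 5}" "fst (prod_decode f) \<noteq> ?l"
      using ring[OF lower(1)] by auto
    obtain y where y: "y \<in> {3, 4}" "ed ?l y \<in> C" using br(15)[OF lower(2)] by blast
    then obtain g where g: "g \<in> {ed ?l 2, ed ?l 7, ed ?l 5, ed ?l 9}" "g \<in> C"
      using br(11) br(16) by blast
    then have g': "g \<notin> {ed ?l 3, ed ?l 4}" "fst (prod_decode g) = ?l" by auto
    have "ed l 9 \<noteq> ed l x" "f \<noteq> ed l x" using x(1) f'(1) by auto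
    moreover have "g \<noteq> ed ?l y" using y(1) g'(1) by auto
    moreover have "ed l x \<noteq> ed ?l y" "ed l 9 \<noteq> ed ?l y" using ring(2)[OF lower(1)] by simp_all
    moreover have "f \<noteq> ed ?l y" using f'(2) by (metis prod_encode_inverse fst_conv)
    moreover have "g \<noteq> ed l x" "g \<noteq> ed l 9"
      using g'(2) ring(2)[OF lower(1)] by (metis prod_encode_inverse fst_conv)+
    moreover have "g \<noteq> f" using f'(2) g'(2) by metis
    moreover have "f \<noteq> ed l 9" using f'(1) by simp
    ultimately show ?thesis
      using x(2) y(2) f(2) g(2) lower(2)
      by (intro five[of g f "ed l 9" "ed l x" "ed ?l y"]) simp_all
  next
    case bead
    obtain e where "e \<in> C" using circuit_nonempty[OF C] by blast
    moreover from this obtain l t where lt: "e = ed l t" "l < 3 * n" "t < 11" using CE edge_cases by blast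
    moreover have "t < 8"
    proof (rule ccontr)
      assume "\<not> t < 8"
      then have "t = 8 \<or> t = 9 \<or> t = 10" using lt(3) by auto
      then show False using bead lt \<open>e \<in> C\<close> by auto
    qed
    ultimately have "{ed l 0, ed l 1, ed l 2, ed l 6, ed l 7} \<subseteq> C \<or> {ed l 3, ed l 4, ed l 5, ed l 6, ed l 7} \<subseteq> C
      \<or> {ed l 0, ed l 1, ed l 2, ed l 3, ed l 4, ed l 5} \<subseteq> C"
      using bead by (intro circuit_in_bead[OF C, of l t]) auto
    then show ?thesis
      using five[of "ed l 0" "ed l 1" "ed l 2" "ed l 6" "ed l 7"]
        five[of "ed l 3" "ed l 4" "ed l 5" "ed l 6" "ed l 7"]
        five[of "ed l 0" "ed l 1" "ed l 2" "ed l 3" "ed l 4"] by auto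
  qed
qed

lemma girth_necklace: "0 < n \<Longrightarrow> 5 \<le> girth (necklace n)"
  unfolding girth_def using circuit_card_ge_5[of n]
  by (intro INF_greatest) (auto simp: numeral_eq_enat)

section \<open>Edge cuts with at most three edges\<close>

lemma ring_succ_neq: "0 < n \<Longrightarrow> l < 3 * n \<Longrightarrow> ring_succ n l \<noteq> l"
  and ring_pred_neq: "0 < n \<Longrightarrow> l < 3 * n \<Longrightarrow> ring_pred n l \<noteq> l"
  unfolding ring_succ_def ring_pred_def by presburger+

lemma cut_iff:
  assumes "l < 3 * n" "t < 11"
  shows "ed l t \<in> edge_cut (necklace n) X \<longleftrightarrow> (fst (link n l t) \<in> X) \<noteq> (snd (link n l t) \<in> X)"
  using assms by (auto simp: edge_cut_def ends_necklace)

lemma finite_cut: "finite (edge_cut (necklace n) X)"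
  by (rule finite_subset[of _ "edges (necklace n)"]) (auto simp: edge_cut_def necklace_def)

lemma four_le_card:
  assumes "distinct [a, b, c, d]" "set [a, b, c, d] \<subseteq> C" "finite C"
  shows "4 \<le> card C"
  using card_mono[OF assms(3,2)] distinct_card[OF assms(1)] by simp

text \<open>A bead is 2-edge-connected: its theta graph stays connected after the loss of any one
  edge \<open>t0\<close>.\<close>

lemma split_bead_cut:
  assumes l: "l < 3 * n" and split: "\<not> (\<forall>j<7. vx l j \<in> X \<longleftrightarrow> vx l 0 \<in> X)"
  shows "\<exists>s t. s \<noteq> t \<and> s < 8 \<and> t < 8 \<and> ed l s \<in> edge_cut (necklace n) X \<and> ed l t \<in> edge_cut (necklace n) X"
proof (rule ccontr)
  assume neg: "\<not> ?thesis"
  have "\<exists>t0<8. \<forall>t<8. t \<noteq> t0 \<longrightarrow> ed l t \<notin> edge_cut (necklace n) X"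
  proof (cases "\<exists>t0<8. ed l t0 \<in> edge_cut (necklace n) X")
    case True then show ?thesis using neg by blast
  next
    case False then show ?thesis by (intro exI[of _ 0]) auto
  qed
  then obtain t0 where t0: "t0 < 8" and no: "\<And>t. t < 8 \<Longrightarrow> t \<noteq> t0 \<Longrightarrow> ed l t \<notin> edge_cut (necklace n) X"
    by blast
  define x where "x j \<longleftrightarrow> vx l j \<in> X" for j
  have c: "t0 \<noteq> 0 \<Longrightarrow> x 0 = x 1" "t0 \<noteq> 1 \<Longrightarrow> x 1 = x 2" "t0 \<noteq> 2 \<Longrightarrow> x 2 = x 3" "t0 \<noteq> 3 \<Longrightarrow> x 3 = x 4"
    "t0 \<noteq> 4 \<Longrightarrow> x 4 = x 5" "t0 \<noteq> 5 \<Longrightarrow> x 5 = x 0" "t0 \<noteq> 6 \<Longrightarrow> x 0 = x 6" "t0 \<noteq> 7 \<Longrightarrow> x 3 = x 6"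
    using no[of 0] no[of 1] no[of 2] no[of 3] no[of 4] no[of 5] no[of 6] no[of 7] l
    by (simp_all add: cut_iff link_simps x_def)
  have "t0 \<in> {0, 1, 2, 3, 4, 5, 6, 7}" using t0 by simp presburger
  then have "x 1 = x 0 \<and> x 2 = x 0 \<and> x 3 = x 0 \<and> x 4 = x 0 \<and> x 5 = x 0 \<and> x 6 = x 0"
    using c by (elim insertE emptyE) simp_all
  moreover have "j \<in> {0, 1, 2, 3, 4, 5, 6}" if "j < 7" for j :: nat using that by simp presburger
  ultimately have "x j = x 0" if "j < 7" for j using that by blast
  then show False using split unfolding x_def by blast
qed

text \<open>A cycle minus one edge is still connected; the induction runs upwards from 0 to
  \<open>a\<close> and downwards from \<open>3 * n - 1\<close> to the successor of
  \<open>a\<close>.\<close>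

lemma ring_constant:
  assumes n: "0 < n" and c: "\<And>l. l < 3 * n \<Longrightarrow> l \<noteq> a \<Longrightarrow> c l = c (ring_succ n l)"
  shows "l < 3 * n \<Longrightarrow> c l = c 0"
proof -
  have up: "c l = c 0" if "l \<le> a" "l < 3 * n" for l
    using that
  proof (induction l)
    case (Suc l)
    then have "c l = c (ring_succ n l)" using c[of l] by simp
    then show ?case using Suc by (simp add: ring_succ_def)
  qed simp
  have down: "c (3 * n - 1 - i) = c 0" if "a < 3 * n - 1 - i" for i
    using that
  proof (induction i)
    case 0
    then show ?case using c[of "3 * n - 1"] n by (simp add: ring_succ_def)
  next
    case (Suc i)
    let ?l = "3 * n - 1 - Suc i"
    have "c ?l = c (ring_succ n ?l)" using Suc.prems by (intro c) auto
    moreover have "ring_succ n ?l = 3 * n - 1 - i" using Suc.prems by (auto simp: ring_succ_def)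
    ultimately show ?case using Suc by simp
  qed
  show "c l = c 0" if "l < 3 * n"
    using up[of l] down[of "3 * n - 1 - l"] that by (cases "l \<le> a") auto
qed

lemma ring_step_cut:
  assumes l: "l < 3 * n"
    and "\<forall>j<7. vx l j \<in> X \<longleftrightarrow> vx l 0 \<in> X"
    and "\<forall>j<7. vx (ring_succ n l) j \<in> X \<longleftrightarrow> vx (ring_succ n l) 0 \<in> X"
    and "(vx l 0 \<in> X) \<noteq> (vx (ring_succ n l) 0 \<in> X)"
  shows "ed l 8 \<in> edge_cut (necklace n) X" "ed l 9 \<in> edge_cut (necklace n) X"
  using assms(2)[rule_format, of 2] assms(2)[rule_format, of 5] assms(3)[rule_format, of 1]
    assms(3)[rule_format, of 4] assms(1,4) by (simp_all add: cut_iff link_simps)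

text \<open>
  A split bead contributes at least two cut edges, as does each change of side between consecutive
  unsplit beads; hence on a small cut one side consists of hubs or is contained in a single bead.
\<close>

lemma small_cut:
  assumes n: "0 < n" and card: "card (edge_cut (necklace n) X) \<le> 3"
  shows "\<exists>c. (\<forall>v\<in>verts (necklace n). (v \<in> X) \<noteq> c \<longrightarrow> (\<exists>k<n. v = vx k 7)) \<or>
    (\<exists>l<3 * n. \<forall>v\<in>verts (necklace n). (v \<in> X) \<noteq> c \<longrightarrow> (\<exists>j<7. v = vx l j))"
proof -
  let ?D = "edge_cut (necklace n) X"
  have four: False if "distinct [a, b, c, d]" "set [a, b, c, d] \<subseteq> ?D" for a b c d
    using four_le_card[OF that finite_cut] card by simp
  define mono where "mono l \<longleftrightarrow> (\<forall>j<7. vx l j \<in> X \<longleftrightarrow> vx l 0 \<in> X)" for l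
  define side where "side l \<longleftrightarrow> vx l 0 \<in> X" for l
  have side: "vx l j \<in> X \<longleftrightarrow> side l" if "mono l" "j < 7" for l j
    using that unfolding mono_def side_def by blast
  have step: "ed l 8 \<in> ?D" "ed l 9 \<in> ?D"
    if "l < 3 * n" "mono l" "mono (ring_succ n l)" "side l \<noteq> side (ring_succ n l)" for l
    using ring_step_cut[of l n X] that unfolding mono_def side_def by blast+
  show ?thesis
  proof (cases "\<forall>l<3 * n. mono l")
    case True
    \<comment> \<open>Two changes of side would cost four ring edges, so \<open>side\<close> is
      constant and only hubs can deviate.\<close>
    have "\<exists>a. \<forall>l<3 * n. l \<noteq> a \<longrightarrow> side l = side (ring_succ n l)"
    proof (rule ccontr)
      assume neg: "\<not> ?thesis"
      then obtain l where l: "l < 3 * n" "side l \<noteq> side (ring_succ n l)" by blast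
      from neg obtain l' where l': "l' < 3 * n" "l' \<noteq> l" "side l' \<noteq> side (ring_succ n l')" by blast
      show False
        using four[of "ed l 8" "ed l 9" "ed l' 8" "ed l' 9"] step[of l] step[of l'] l l' True by simp
    qed
    then obtain a where "\<And>l. l < 3 * n \<Longrightarrow> l \<noteq> a \<Longrightarrow> side l = side (ring_succ n l)" by blast
    from ring_constant[OF n, of a side, OF this] have const: "side l = side 0" if "l < 3 * n" for l using that by blast
    have hubs: "\<exists>k<n. v = vx k 7" if v: "v \<in> verts (necklace n)" "(v \<in> X) \<noteq> side 0" for v
      using v(1)
    proof (cases rule: vert_cases)
      case (bead l j)
      then show ?thesis using side[of l j] True const[of l] v(2) by simp
    qed blast
    show ?thesis by (intro exI[of _ "side 0"] disjI1 ballI impI hubs)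
  next
    case False
    then obtain l0 where l0: "l0 < 3 * n" "\<not> mono l0" by blast
    from split_bead_cut[OF l0(1) l0(2)[unfolded mono_def]]
    obtain s t where st: "s \<noteq> t" "s < 8" "t < 8" "ed l0 s \<in> ?D" "ed l0 t \<in> ?D" by blast
    \<comment> \<open>The split bead uses up two cut edges; from here on any two cut edges elsewhere
      are a contradiction.\<close>
    note four' = four[of "ed l0 s" "ed l0 t"]
    have mono: "mono l" if "l < 3 * n" "l \<noteq> l0" for l
    proof (rule ccontr)
      assume "\<not> mono l"
      from split_bead_cut[OF that(1) this[unfolded mono_def]]
      obtain s' t' where "s' \<noteq> t'" "ed l s' \<in> ?D" "ed l t' \<in> ?D" by blast
      then show False using four'[of "ed l s'" "ed l t'"] st that by simp
    qed
    have step0: "side l = side (ring_succ n l)" if "l < 3 * n" "l \<noteq> l0" "ring_succ n l \<noteq> l0" for l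
    proof (rule ccontr)
      assume "side l \<noteq> side (ring_succ n l)"
      then have "ed l 8 \<in> ?D" "ed l 9 \<in> ?D" using step[of l] mono that by auto
      then show False using four'[of "ed l 8" "ed l 9"] st that by simp
    qed
    \<comment> \<open>The split bead has no side of its own. Lending it that of its successor leaves
      only the step into \<open>l0\<close> open, as \<open>ring_constant\<close> permits.\<close>
    define side' where "side' l = (if l = l0 then side (ring_succ n l0) else side l)" for l
    have "ring_succ n l0 \<noteq> l0" using ring_succ_neq[OF n l0(1)] .
    then have "side' l = side' (ring_succ n l)" if "l < 3 * n" "l \<noteq> ring_pred n l0" for l
      using that step0[of l] ring_succ_eq_iff[of l n l0] l0(1) by (auto simp: side'_def)
    from ring_constant[OF n, of "ring_pred n l0" side', OF this] have const: "side l = side' 0" if "l < 3 * n" "l \<noteq> l0" for l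
      using that by (metis side'_def)
    have in_bead: "\<exists>j<7. v = vx l0 j" if v: "v \<in> verts (necklace n)" "(v \<in> X) \<noteq> side' 0" for v
      using v(1)
    proof (cases rule: vert_cases)
      case (bead l j)
      then show ?thesis using side[of l j] mono[of l] const[of l] v(2) by auto
    next
      \<comment> \<open>At least two of the three beads of a deviating hub differ from
        \<open>l0\<close>, and both of their hub edges are cut.\<close>
      case (hub k)
      have cutl: "ed l 10 \<in> ?D" if "l < 3 * n" "l \<noteq> l0" "hub n l = k" for l
        using that side[of l 6] mono[of l] const[of l] v(2) hub by (auto simp: cut_iff link_simps)
      have less: "2 * k < 3 * n" "2 * k + 1 < 3 * n" "3 * n - 1 - k < 3 * n" using hub by auto
      have h: "hub n (2 * k) = k" "hub n (2 * k + 1) = k" "hub n (3 * n - 1 - k) = k"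
        using hub by (auto simp: hub_def)
      have ne: "2 * k \<noteq> 2 * k + 1" "2 * k \<noteq> 3 * n - 1 - k" "2 * k + 1 \<noteq> 3 * n - 1 - k" using hub by auto
      have "\<exists>l l'. l \<noteq> l' \<and> ed l 10 \<in> ?D \<and> ed l' 10 \<in> ?D"
        using cutl[OF less(1) _ h(1)] cutl[OF less(2) _ h(2)] cutl[OF less(3) _ h(3)] ne by metis
      then obtain l l' where "l \<noteq> l'" "ed l 10 \<in> ?D" "ed l' 10 \<in> ?D" by blast
      then have False using four'[of "ed l 10" "ed l' 10"] st by simp
      then show ?thesis ..
    qed
    show ?thesis by (intro exI[of _ "side' 0"] disjI2 exI[of _ l0] conjI l0(1) ballI impI in_bead)
  qed
qed

text \<open>Only the exceptional sides left by \<open>small_cut\<close> remain: a hub is cut from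
  its beads, a whole bead from the next bead by two ring edges, and a split bead has two cut edges
  inside.\<close>

lemma cut_ge_2:
  assumes n: "0 < n" and X: "X \<noteq> {}" "X \<subset> verts (necklace n)"
  shows "2 \<le> card (edge_cut (necklace n) X)"
proof (rule ccontr)
  let ?D = "edge_cut (necklace n) X"
  assume neg: "\<not> 2 \<le> card ?D"
  have two: False if "a \<noteq> b" "a \<in> ?D" "b \<in> ?D" for a b
    using card_mono[OF finite_cut, of "{a, b}" n X] that neg by auto
  have "card ?D \<le> 3" using neg by simp
  from small_cut[OF n this] obtain c where
    "(\<forall>v\<in>verts (necklace n). (v \<in> X) \<noteq> c \<longrightarrow> (\<exists>k<n. v = vx k 7)) \<or>
      (\<exists>l<3 * n. \<forall>v\<in>verts (necklace n). (v \<in> X) \<noteq> c \<longrightarrow> (\<exists>j<7. v = vx l j))" ..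
  then consider
      (hubs) "\<And>v. v \<in> verts (necklace n) \<Longrightarrow> (v \<in> X) \<noteq> c \<Longrightarrow> \<exists>k<n. v = vx k 7"
    | (bead) l where "l < 3 * n"
        "\<And>v. v \<in> verts (necklace n) \<Longrightarrow> (v \<in> X) \<noteq> c \<Longrightarrow> \<exists>j<7. v = vx l j" by blast
  then show False
  proof cases
    case hubs
    obtain v where v: "v \<in> verts (necklace n)" "(v \<in> X) \<noteq> c" using X by (cases c) auto
    from hubs[OF this] obtain k where k: "k < n" "v = vx k 7" by blast
    have D: "ed l 10 \<in> ?D" if l: "l < 3 * n" "hub n l = k" for l
    proof -
      have "(vx l 6 \<in> X) = c" using hubs[of "vx l 6"] l by (auto simp: vx_in_verts)
      then show ?thesis using l k v by (auto simp: cut_iff link_simps)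
    qed
    show False using two[OF _ D[of "2 * k"] D[of "2 * k + 1"]] k(1) by (simp add: hub_def)
  next
    case (bead l)
    have succ: "ring_succ n l \<noteq> l" using ring_succ_neq[OF n bead(1)] .
    have out: "(vx (ring_succ n l) j \<in> X) = c" if "j < 7" for j
      using bead(2)[of "vx (ring_succ n l) j"] bead(1) that succ by (auto simp: vx_in_verts)
    show False
    proof (cases "\<forall>j<7. vx l j \<in> X \<longleftrightarrow> vx l 0 \<in> X")
      case True
      obtain v where v: "v \<in> verts (necklace n)" "(v \<in> X) \<noteq> c" using X by (cases c) auto
      from bead(2)[OF this] obtain j where "j < 7" "v = vx l j" by blast
      then have "(vx l i \<in> X) \<noteq> c" if "i < 7" for i using True v(2) that by blast
      then show False
        using two[of "ed l 8" "ed l 9"] out[of 1] out[of 4] bead(1) by (simp add: cut_iff link_simps)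
    next
      case False
      from split_bead_cut[OF bead(1) this] obtain s t where "s \<noteq> t" "ed l s \<in> ?D" "ed l t \<in> ?D" by blast
      then show False using two[of "ed l s" "ed l t"] by simp
    qed
  qed
qed

lemma k_connected_necklace: "0 < n \<Longrightarrow> k_connected 2 (necklace n)"
  using finite_graph.k_connected_2I[OF finite_necklace cubic_necklace, of n] cut_ge_2[of n]
  by (simp add: card_verts_necklace)

text \<open>For the hexagon the four ring edges of the bead leave \<open>X\<close>. A circuit of
  length 5 loses three outward edges, and a fourth comes from the neighbouring hexagon vertex off
  the circuit: its ring edge if it lies in \<open>X\<close>, otherwise the edge leading to
  it.\<close>

lemma circuit_in_bead_cut:
  assumes C: "circuit (necklace n) C" and l: "l < 3 * n" and n: "0 < n"
    and CX: "covered_verts (necklace n) C \<subseteq> X"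
    and X: "\<And>v. v \<in> verts (necklace n) \<Longrightarrow> v \<in> X \<Longrightarrow> \<exists>j<7. v = vx l j"
  shows "4 \<le> card (edge_cut (necklace n) X)"
proof -
  let ?D = "edge_cut (necklace n) X" and ?p = "ring_pred n l" and ?s = "ring_succ n l"
  note four = four_le_card[OF _ _ finite_cut]
  have CE: "C \<subseteq> edges (necklace n)" using C by (simp add: circuit_iff)
  have ends: "fst (link n l' t) \<in> X" "snd (link n l' t) \<in> X" if "ed l' t \<in> C" for l' t
  proof -
    have "fst (link n l' t) \<in># ends (necklace n) (ed l' t)" "snd (link n l' t) \<in># ends (necklace n) (ed l' t)"
      by (simp_all add: ends_necklace)
    then show "fst (link n l' t) \<in> X" "snd (link n l' t) \<in> X"
      using that CX unfolding covered_verts_def by blast+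
  qed
  have ring: "?p \<noteq> l" "?s \<noteq> l" using ring_pred_neq[OF n l] ring_succ_neq[OF n l] by auto
  have inX: "l' = l" if "vx l' j \<in> X" "vx l' j \<in> verts (necklace n)" for l' j
    using X[OF that(2,1)] by auto
  have notX: "vx l' j \<notin> X" if "l' < 3 * n" "j < 7" "l' \<noteq> l" for l' j
    using inX[of l' j] that by (auto simp: vx_in_verts)
  have hubX: "vx k 7 \<notin> X" if "k < n" for k using X[of "vx k 7"] that by (auto simp: vx_in_verts)
  have out: "vx ?s 1 \<notin> X" "vx ?s 4 \<notin> X" "vx ?p 2 \<notin> X" "vx ?p 5 \<notin> X" "vx (hub n l) 7 \<notin> X"
    using notX hubX ring l by simp_all
  have no: "ed l 8 \<notin> C" "ed l 9 \<notin> C" "ed l 10 \<notin> C" "ed ?p 8 \<notin> C" "ed ?p 9 \<notin> C"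
    using ends[of l 8] ends[of l 9] ends[of l 10] ends[of ?p 8] ends[of ?p 9] out
    by (auto simp: link_simps)
  obtain e where e: "e \<in> C" using circuit_nonempty[OF C] by blast
  then obtain l' t where lt: "e = ed l' t" "l' < 3 * n" "t < 11" using CE edge_cases by blast
  have "\<exists>j<7. fst (link n l' t) = vx l' j" using less_11_cases[OF lt(3)] by (auto simp: link_simps)
  then obtain j where j: "j < 7" "fst (link n l' t) = vx l' j" by blast
  have "ed l' t \<in> C" using e lt(1) by simp
  from ends(1)[OF this] have "vx l' j \<in> X" unfolding j(2) .
  then have l': "l' = l" using notX[OF lt(2) j(1)] by blast
  have "t < 8"
  proof (rule ccontr)
    assume "\<not> t < 8"
    then have "t = 8 \<or> t = 9 \<or> t = 10" using lt(3) by auto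
    then show False using no e lt l' by auto
  qed
  have D: "vx l 1 \<in> X \<Longrightarrow> ed ?p 8 \<in> ?D" "vx l 4 \<in> X \<Longrightarrow> ed ?p 9 \<in> ?D" "vx l 2 \<in> X \<Longrightarrow> ed l 8 \<in> ?D"
    "vx l 5 \<in> X \<Longrightarrow> ed l 9 \<in> ?D" "vx l 6 \<in> X \<Longrightarrow> ed l 10 \<in> ?D"
    "vx l 3 \<in> X \<Longrightarrow> vx l 4 \<notin> X \<Longrightarrow> ed l 3 \<in> ?D" "vx l 0 \<in> X \<Longrightarrow> vx l 1 \<notin> X \<Longrightarrow> ed l 0 \<in> ?D"
    using l out by (simp_all add: cut_iff link_simps)
  have e8: "e = ed l t" using lt(1) l' by simp
  from circuit_in_bead[OF C l _ \<open>t < 8\<close> no] e e8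
  consider "{ed l 0, ed l 1, ed l 2, ed l 6, ed l 7} \<subseteq> C" | "{ed l 3, ed l 4, ed l 5, ed l 6, ed l 7} \<subseteq> C"
    | "{ed l 0, ed l 1, ed l 2, ed l 3, ed l 4, ed l 5} \<subseteq> C" by blast
  then show ?thesis
  proof cases
    case 1
    then have "vx l 0 \<in> X" "vx l 1 \<in> X" "vx l 2 \<in> X" "vx l 3 \<in> X" "vx l 6 \<in> X"
      using ends[of l 0] ends[of l 1] ends[of l 2] ends[of l 6] by (simp_all add: link_simps)
    then show ?thesis
      using D ring four[of "ed ?p 8" "ed l 8" "ed l 10" "ed ?p 9" n X]
        four[of "ed ?p 8" "ed l 8" "ed l 10" "ed l 3" n X] by (cases "vx l 4 \<in> X") simp_all
  next
    case 2
    then have "vx l 0 \<in> X" "vx l 3 \<in> X" "vx l 4 \<in> X" "vx l 5 \<in> X" "vx l 6 \<in> X"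
      using ends[of l 3] ends[of l 4] ends[of l 5] ends[of l 6] by (simp_all add: link_simps)
    then show ?thesis
      using D ring four[of "ed ?p 9" "ed l 9" "ed l 10" "ed ?p 8" n X]
        four[of "ed ?p 9" "ed l 9" "ed l 10" "ed l 0" n X] by (cases "vx l 1 \<in> X") simp_all
  next
    case 3
    then have "vx l 1 \<in> X" "vx l 2 \<in> X" "vx l 4 \<in> X" "vx l 5 \<in> X"
      using ends[of l 0] ends[of l 1] ends[of l 3] ends[of l 4] by (simp_all add: link_simps)
    then show ?thesis
      using D ring four[of "ed ?p 8" "ed l 8" "ed ?p 9" "ed l 9" n X] by simp
  qed
qed

text \<open>Hubs are pairwise nonadjacent: the first end of each \<open>link\<close> lies in a
  bead.\<close>

lemma circuit_not_in_hubs: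
  assumes C: "circuit (necklace n) C"
    and X: "\<And>v. v \<in> covered_verts (necklace n) C \<Longrightarrow> \<exists>k. v = vx k 7"
  shows False
proof -
  obtain e where e: "e \<in> C" using circuit_nonempty[OF C] by blast
  have "C \<subseteq> edges (necklace n)" using C by (simp add: circuit_iff)
  then obtain l t where lt: "e = ed l t" "l < 3 * n" "t < 11" using e edge_cases by blast
  have "fst (link n l t) \<in># ends (necklace n) e" by (simp add: lt ends_necklace)
  then have "fst (link n l t) \<in> covered_verts (necklace n) C" using e unfolding covered_verts_def by blast
  moreover have "\<exists>j<7. fst (link n l t) = vx l j" using less_11_cases[OF lt(3)] by (auto simp: link_simps)
  ultimately show False using X by fastforce
qed

lemma cut_Compl: "edge_cut (necklace n) (verts (necklace n) - X) = edge_cut (necklace n) X"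
proof -
  interpret finite_graph "necklace n" by (rule finite_necklace)
  have "set_mset (ends (necklace n) e) \<subseteq> verts (necklace n)" if "e \<in> edges (necklace n)" for e
    using fin that by (auto simp: finite_multigraph_def)
  then show ?thesis by (auto simp: edge_cut_def)
qed

text \<open>All edges leaving the component \<open>K1\<close> belong to \<open>S\<close>, so its cut
  is small, and by \<open>small_cut\<close> either \<open>K1\<close> or its complement consists of
  hubs or sits in one bead. Both contain a circuit, \<open>C1\<close> or \<open>C2\<close>, which is
  impossible there.\<close>

lemma cyclically_4_edge_connected_necklace:
  assumes n: "0 < n"
  shows "cyclically_edge_connected 4 (necklace n)"
  unfolding cyclically_edge_connected_def
proof (intro notI, elim exE conjE)
  let ?G = "necklace n"
  fix S assume S: "S \<subseteq> edges ?G" "card S < 4"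
  let ?K = "{K \<in> components (delete_edges ?G S).
    \<exists>C. circuit (delete_edges ?G S) C \<and> (\<forall>e\<in>C. set_mset (ends ?G e) \<subseteq> K)}"
  assume two: "2 \<le> card ?K"
  interpret finite_graph ?G by (rule finite_necklace)
  have "\<not> card ?K \<le> Suc 0" "finite ?K" using two by (auto intro: card_ge_0_finite)
  then obtain K1 K2 where K: "K1 \<in> ?K" "K2 \<in> ?K" "K1 \<noteq> K2" using card_le_Suc0_iff_eq[of ?K] by blast
  let ?R = "adjacency (delete_edges ?G S)"
  obtain u1 u2 where K1: "K1 = {v \<in> verts ?G. (u1, v) \<in> ?R\<^sup>*}" and K2: "K2 = {v \<in> verts ?G. (u2, v) \<in> ?R\<^sup>*}"
    using K by (auto simp: components_def delete_edges_def)
  have disj: "K1 \<inter> K2 = {}"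
  proof (rule ccontr)
    assume "K1 \<inter> K2 \<noteq> {}"
    then obtain v where "(u1, v) \<in> ?R\<^sup>*" "(u2, v) \<in> ?R\<^sup>*" by (auto simp: K1 K2)
    then have "(u1, u2) \<in> ?R\<^sup>*" "(u2, u1) \<in> ?R\<^sup>*" by (meson reachable_sym rtrancl_trans)+
    then have "(u1, w) \<in> ?R\<^sup>* \<longleftrightarrow> (u2, w) \<in> ?R\<^sup>*" for w by (meson rtrancl_trans)
    then show False using K(3) by (simp add: K1 K2)
  qed
  obtain C1 where C1: "circuit (delete_edges ?G S) C1" "\<forall>e\<in>C1. set_mset (ends ?G e) \<subseteq> K1"
    using K(1) by blast
  obtain C2 where C2: "circuit (delete_edges ?G S) C2" "\<forall>e\<in>C2. set_mset (ends ?G e) \<subseteq> K2"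
    using K(2) by blast
  have C: "circuit ?G C1" "circuit ?G C2" using C1(1) C2(1) by (simp_all add: circuit_delete_edges)
  have "edge_cut ?G K1 \<subseteq> S"
  proof
    fix e assume e: "e \<in> edge_cut ?G K1"
    then have eE: "e \<in> edges ?G" by (simp add: edge_cut_def)
    then obtain a b where ab: "ends ?G e = {#a, b#}" "a \<in> verts ?G" "b \<in> verts ?G" by (rule edge_ends)
    show "e \<in> S"
    proof (rule ccontr)
      assume "e \<notin> S"
      then have "(a, b) \<in> ?R" using eE ab by (auto simp: adjacency_def delete_edges_def)
      then have "(a, b) \<in> ?R" "(b, a) \<in> ?R" using symD[OF sym_adjacency] by auto
      then have "a \<in> K1 \<longleftrightarrow> b \<in> K1" using ab by (auto simp: K1 intro: rtrancl_into_rtrancl)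
      then show False using e ab by (auto simp: edge_cut_def)
    qed
  qed
  moreover have "finite S" using S(1) finite_edge_subset by blast
  ultimately have small: "card (edge_cut ?G K1) \<le> 3" using card_mono[of S "edge_cut ?G K1"] S(2) by simp
  have sub1: "covered_verts ?G C1 \<subseteq> K1" and "covered_verts ?G C2 \<subseteq> K2"
    using C1(2) C2(2) by (auto simp: covered_verts_def)
  moreover have "K2 \<subseteq> verts ?G - K1" using disj K2 by blast
  ultimately have sub2: "covered_verts ?G C2 \<subseteq> verts ?G - K1" by blast
  have no: False if cX: "card (edge_cut ?G X) \<le> 3" and XV: "X \<subseteq> verts ?G" and CX: "circuit ?G C" "covered_verts ?G C \<subseteq> X"
    and alt: "(\<forall>v\<in>verts ?G. v \<in> X \<longrightarrow> (\<exists>k<n. v = vx k 7)) \<or>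
      (\<exists>l<3 * n. \<forall>v\<in>verts ?G. v \<in> X \<longrightarrow> (\<exists>j<7. v = vx l j))" for X C
    using alt
  proof (elim disjE exE conjE)
    assume "\<forall>v\<in>verts ?G. v \<in> X \<longrightarrow> (\<exists>k<n. v = vx k 7)"
    then show False using circuit_not_in_hubs[OF CX(1)] XV CX(2) by blast
  next
    fix l assume "l < 3 * n" "\<forall>v\<in>verts ?G. v \<in> X \<longrightarrow> (\<exists>j<7. v = vx l j)"
    then have "4 \<le> card (edge_cut ?G X)" by (intro circuit_in_bead_cut[OF CX(1) _ n CX(2)]) auto
    then show False using cX by simp
  qed
  obtain c where c: "(\<forall>v\<in>verts ?G. (v \<in> K1) \<noteq> c \<longrightarrow> (\<exists>k<n. v = vx k 7)) \<or>
    (\<exists>l<3 * n. \<forall>v\<in>verts ?G. (v \<in> K1) \<noteq> c \<longrightarrow> (\<exists>j<7. v = vx l j))"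
    using small_cut[OF n small] by blast
  show False
  proof (cases c)
    case True
    show False
      by (rule no[of "verts ?G - K1", OF _ _ C(2) sub2]) (use small c True in \<open>auto simp: cut_Compl\<close>)
  next
    case False
    show False by (rule no[of K1, OF small _ C(1) sub1]) (use c False in \<open>auto simp: K1\<close>)
  qed
qed

section \<open>Oddness\<close>

text \<open>
  For even \<open>n\<close>, a colouring with the colours 1, 2, 3 which is proper except at the hubs 0 and \<open>n - 1\<close>,
  where the colours are 1, 2, 2. The hue of a bead is the colour of its edge to the hub; one pair of
  ring edges of the bead is monochromatic, the other has the two colours different from the hue.
\<close>

definition hue :: "nat \<Rightarrow> nat \<Rightarrow> nat" where
  "hue n l = (if l < 2 * n then if l mod 4 \<in> {0, 3} then 2 else 1
    else if l = 2 * n \<or> l = 3 * n - 1 then 2 else 3)"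

text \<open>Beads below \<open>2 * n\<close> have hue 1 or 2 and monochromatic pairs of colour 3,
  the others hue 2 or 3 and monochromatic pairs of colour 1; \<open>c\<close> is the colour left
  over. The monochromatic pair follows an even bead and precedes an odd one.\<close>

definition shade :: "nat \<Rightarrow> nat \<Rightarrow> nat \<Rightarrow> nat" where
  "shade n l t = (let a = hue n l; c = (if l < 2 * n then 3 - a else 5 - a) in
    (if l < 2 * n
     then if even l then [a, c, a, 3, a, c, 3, c, 3, 3, a] else [a, c, a, c, a, 3, c, 3, 3, c, a]
     else if even l then [1, a, c, a, c, a, c, 1, 1, 1, a] else [c, a, 1, a, c, a, 1, c, c, 1, a]) ! t)"

definition edge_shade :: "nat \<Rightarrow> nat \<Rightarrow> nat" where
  "edge_shade n e = shade n (fst (prod_decode e)) (snd (prod_decode e))"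

lemma edge_shade_ed [simp]: "edge_shade n (ed l t) = shade n l t"
  by (simp add: edge_shade_def)

lemmas shade_simps = shade_def[of _ _ 0, unfolded Let_def, simplified]
  shade_def[of _ _ 1, unfolded Let_def, simplified]
  shade_def[of _ _ 2, unfolded Let_def, simplified]
  shade_def[of _ _ 3, unfolded Let_def, simplified]
  shade_def[of _ _ 4, unfolded Let_def, simplified]
  shade_def[of _ _ 5, unfolded Let_def, simplified]
  shade_def[of _ _ 6, unfolded Let_def, simplified]
  shade_def[of _ _ 7, unfolded Let_def, simplified]
  shade_def[of _ _ 8, unfolded Let_def, simplified]
  shade_def[of _ _ 9, unfolded Let_def, simplified]
  shade_def[of _ _ 10, unfolded Let_def, simplified]

lemma hue_cases: "l < 2 * n \<Longrightarrow> hue n l = 1 \<or> hue n l = 2" "2 * n \<le> l \<Longrightarrow> hue n l = 2 \<or> hue n l = 3"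
  by (auto simp: hue_def)

text \<open>An even bead is entered by the pair that avoids the hue, so the hue must persist there.
  Where the two chains meet, this pair is {3, 3 - a} on one side and {1, 5 - b} on the other for
  hues a and b, which forces both hues to be 2; this causes the conflicts at the hubs 0 and
  \<open>n - 1\<close>.\<close>

lemma hue_pred_even:
  assumes n: "even n" "0 < n" and l: "l < 3 * n" "even l"
  shows "l \<noteq> 0 \<Longrightarrow> l \<noteq> 2 * n \<Longrightarrow> hue n (l - 1) = hue n l"
    and "hue n 0 = 2" "hue n (2 * n) = 2" "hue n (2 * n - 1) = 2" "hue n (3 * n - 1) = 2"
proof -
  obtain m where "n = 2 * m" using n by (auto elim: evenE)
  then obtain i where i: "n = 2 * Suc i" using n(2) by (cases m) auto
  show "hue n 0 = 2" "hue n (2 * n) = 2" "hue n (3 * n - 1) = 2" using n by (auto simp: hue_def)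
  have "2 * n - 1 = 4 * i + 3" by (simp add: i)
  then have "(2 * n - 1) mod 4 = 3" by presburger
  then show "hue n (2 * n - 1) = 2" using n(2) by (simp add: hue_def)
  assume l0: "l \<noteq> 0" "l \<noteq> 2 * n"
  show "hue n (l - 1) = hue n l"
  proof (cases "l < 2 * n")
    case True
    obtain q where "l = 2 * q" using l(2) by (auto elim: evenE)
    then obtain r where r: "l = 2 * Suc r" using l0(1) by (cases q) auto
    have "(2 * r + 1) mod 4 \<in> {0, 3} \<longleftrightarrow> (2 * r + 2) mod 4 \<in> {0, 3}"
      unfolding insert_iff empty_iff by presburger
    then show ?thesis using True by (simp add: hue_def r)
  next
    case False
    have "odd (3 * n - 1)" using n by simp
    then have "l \<noteq> 3 * n - 1" using l(2) by blast
    moreover have "l - 1 \<noteq> 3 * n - 1" using l(1) l0(1) by linarith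
    moreover have "odd (l - 1)" using l(2) l0(1) by simp
    then have "l - 1 \<noteq> 2 * n" by (metis dvd_triv_left)
    moreover have "\<not> l - 1 < 2 * n" using False l0(2) by linarith
    ultimately show ?thesis using False l0 by (simp add: hue_def)
  qed
qed

text \<open>Expresses the entering ring edges by the hue of the bead itself, so that properness
  becomes a finite check inside one bead.\<close>

lemma shade_pred:
  assumes n: "even n" "0 < n" and l: "l < 3 * n"
  defines "p \<equiv> ring_pred n l"
  shows "shade n p 8 = (if l < 2 * n then 3 else if even l then 5 - hue n l else 1)"
    and "shade n p 9 = (if l < 2 * n then if even l then 3 - hue n l else 3 else 1)"
proof -
  have *: "shade n p 8 = (if l < 2 * n then 3 else if even l then 5 - hue n l else 1) \<and>
    shade n p 9 = (if l < 2 * n then if even l then 3 - hue n l else 3 else 1)"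
  proof (cases "even l")
    case True
    note h = hue_pred_even[OF n l True]
    consider "l = 0" | "l = 2 * n" | "l \<noteq> 0" "l \<noteq> 2 * n" by blast
    then show ?thesis
    proof cases
      case 1
      moreover have "odd (3 * n - 1)" "\<not> 3 * n - 1 < 2 * n" using n by auto
      ultimately show ?thesis using h n by (simp add: p_def ring_pred_def shade_simps)
    next
      case 2
      moreover have "odd (2 * n - 1)" "2 * n - 1 < 2 * n" using n by auto
      ultimately show ?thesis using h n by (simp add: p_def ring_pred_def shade_simps)
    next
      case 3
      moreover have "odd (l - 1)" "l - 1 < 2 * n \<longleftrightarrow> l < 2 * n" using 3 True by auto
      ultimately show ?thesis using h True by (simp add: p_def ring_pred_def shade_simps)
    qed
  next
    case False
    then have "even (l - 1)" "l - 1 < 2 * n \<longleftrightarrow> l < 2 * n" "l \<noteq> 0"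
      using n by presburger+
    then show ?thesis using False by (simp add: p_def ring_pred_def shade_simps)
  qed
  then show "shade n p 8 = (if l < 2 * n then 3 else if even l then 5 - hue n l else 1)"
    and "shade n p 9 = (if l < 2 * n then if even l then 3 - hue n l else 3 else 1)" by blast+
qed

lemma shade_bead:
  assumes n: "even n" "0 < n" and l: "l < 3 * n" and j: "j < 7"
  shows "distinct (map (edge_shade n) (star n l j))" "set (map (edge_shade n) (star n l j)) \<subseteq> {1, 2, 3}"
proof -
  have "distinct (map (edge_shade n) (star n l j)) \<and> set (map (edge_shade n) (star n l j)) \<subseteq> {1, 2, 3}"
  proof (cases "l < 2 * n")
    case True
    show ?thesis using less_7_cases[OF j] hue_cases(1)[OF True] True
      by (cases "even l"; elim insertE emptyE disjE;
          simp only: star_simps list.map edge_shade_ed shade_pred[OF n l]; simp add: shade_simps)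
  next
    case False
    then have "2 * n \<le> l" by simp
    show ?thesis using less_7_cases[OF j] hue_cases(2)[OF \<open>2 * n \<le> l\<close>] False
      by (cases "even l"; elim insertE emptyE disjE;
          simp only: star_simps list.map edge_shade_ed shade_pred[OF n l]; simp add: shade_simps)
  qed
  then show "distinct (map (edge_shade n) (star n l j))"
    "set (map (edge_shade n) (star n l j)) \<subseteq> {1, 2, 3}" by blast+
qed

lemma shade_10: "shade n l 10 = hue n l"
  by (simp add: shade_simps)

lemma shade_hub:
  assumes k: "k < n"
  shows "map (edge_shade n) (star n k 7) =
    [if even k then 2 else 1, if even k then 1 else 2, if k = 0 \<or> k = n - 1 then 2 else 3]"
proof -
  have "2 * k mod 4 \<in> {0, 3} \<longleftrightarrow> even k" "(2 * k + 1) mod 4 \<in> {0, 3} \<longleftrightarrow> odd k"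
    unfolding insert_iff empty_iff by presburger+
  moreover have "3 * n - 1 - k = 2 * n \<longleftrightarrow> k = n - 1" "3 * n - 1 - k = 3 * n - 1 \<longleftrightarrow> k = 0"
    "\<not> 3 * n - 1 - k < 2 * n" "2 * k < 2 * n" "2 * k + 1 < 2 * n" using k by auto
  ultimately show ?thesis by (simp add: star_simps shade_10 hue_def)
qed

lemma edge_degree_shade:
  assumes v: "vx l j \<in> verts (necklace n)"
  shows "edge_degree (necklace n) {e \<in> edges (necklace n). P (edge_shade n e)} (vx l j) =
    (\<Sum>x\<leftarrow>map (edge_shade n) (star n l j). of_bool (P x))"
proof -
  have "edge_degree (necklace n) {e \<in> edges (necklace n). P (edge_shade n e)} (vx l j) =
      (\<Sum>e\<leftarrow>star n l j. of_bool (e \<in> {e \<in> edges (necklace n). P (edge_shade n e)}))"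
    by (rule edge_degree_necklace[OF _ v]) auto
  also have "\<dots> = (\<Sum>e\<leftarrow>star n l j. of_bool (P (edge_shade n e)))"
    using star_subset[OF v] by (intro arg_cong[where f = sum_list] map_cong) auto
  finally show ?thesis by (simp add: o_def)
qed

lemma bead_shade_count:
  assumes n: "even n" "0 < n" and l: "l < 3 * n" and j: "j < 7"
  shows "(\<Sum>x\<leftarrow>map (edge_shade n) (star n l j). of_bool (P x)) =
    (of_bool (P 1) + of_bool (P 2) + of_bool (P 3) :: nat)"
proof -
  let ?xs = "map (edge_shade n) (star n l j)"
  note s = shade_bead[OF n l j]
  have v: "vx l j \<in> verts (necklace n)" using l j by (simp add: vx_in_verts)
  have "card (set ?xs) = 3" using distinct_card[OF s(1)] length_star[OF v] by simp
  then have "set ?xs = {1, 2, 3}" using s(2) by (intro card_subset_eq) auto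
  then show ?thesis using sum_list_distinct_conv_sum_set[OF s(1), of "\<lambda>x. of_bool (P x) :: nat"] by simp
qed

section \<open>Oddness, defect and non-colourability for even n\<close>

context
  fixes n :: nat
  assumes n: "even n" "0 < n"
begin

text \<open>Colour 1 occurs once even at the two conflicting hubs, so it is a perfect matching whose
  complement is a 2-factor. Only colour 2 fails to be a matching, and only at these hubs.\<close>

lemma shade_degree:
  assumes v: "v \<in> verts (necklace n)"
  shows "edge_degree (necklace n) {e \<in> edges (necklace n). edge_shade n e = 1} v = 1"
    and "edge_degree (necklace n) {e \<in> edges (necklace n). edge_shade n e \<noteq> 1} v = 2"
    and "v \<notin> {vx 0 7, vx (n - 1) 7} \<Longrightarrow>
      edge_degree (necklace n) {e \<in> edges (necklace n). edge_shade n e = 2} v = 1"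
proof -
  have *: "edge_degree (necklace n) {e \<in> edges (necklace n). edge_shade n e = 1} v = 1 \<and>
    edge_degree (necklace n) {e \<in> edges (necklace n). edge_shade n e \<noteq> 1} v = 2 \<and>
    (v \<notin> {vx 0 7, vx (n - 1) 7} \<longrightarrow>
      edge_degree (necklace n) {e \<in> edges (necklace n). edge_shade n e = 2} v = 1)"
    using v
  proof (cases rule: vert_cases)
    case (bead l j)
    then have "vx l j \<in> verts (necklace n)" using v by simp
    note d = edge_degree_shade[OF this] and c = bead_shade_count[OF n bead(2,3)]
    show ?thesis unfolding bead(1) d[of "\<lambda>x. x = 1"] d[of "\<lambda>x. x \<noteq> 1"] d[of "\<lambda>x. x = 2"] c by simp
  next
    case (hub k)
    then have "vx k 7 \<in> verts (necklace n)" using v by simp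
    note d = edge_degree_shade[OF this]
    show ?thesis
      unfolding hub(1) d[of "\<lambda>x. x = 1"] d[of "\<lambda>x. x \<noteq> 1"] d[of "\<lambda>x. x = 2"] shade_hub[OF hub(2)]
      by simp
  qed
  then show "edge_degree (necklace n) {e \<in> edges (necklace n). edge_shade n e = 1} v = 1"
    and "edge_degree (necklace n) {e \<in> edges (necklace n). edge_shade n e \<noteq> 1} v = 2"
    and "v \<notin> {vx 0 7, vx (n - 1) 7} \<Longrightarrow>
      edge_degree (necklace n) {e \<in> edges (necklace n). edge_shade n e = 2} v = 1" by blast+
qed

lemma perfect_matching_shade:
  "perfect_matching (necklace n) {e \<in> edges (necklace n). edge_shade n e = 1}"
  unfolding perfect_matching_iff using shade_degree(1) by auto

lemma two_factor_shade:
  "two_factor (necklace n) {e \<in> edges (necklace n). edge_shade n e \<noteq> 1}"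
  unfolding two_factor_iff using shade_degree(2) by auto

lemma no_perfect_matching_cover:
  assumes "perfect_matching (necklace n) M1" "perfect_matching (necklace n) M2"
    "perfect_matching (necklace n) M3"
  shows "edges (necklace n) - (M1 \<union> M2 \<union> M3) \<noteq> {}"
proof -
  interpret three_matchings n M1 M2 M3 by (rule three_matchings.intro) (use assms in auto)
  show ?thesis using card_uncovered n(2) by (intro notI) simp
qed

lemma oddness_necklace: "oddness (necklace n) = 2"
  unfolding oddness_def
proof (rule cInf_eq_minimum)
  interpret finite_graph "necklace n" by (rule finite_necklace)
  have ge: "2 \<le> card (odd_circuits (necklace n) F)" if "two_factor (necklace n) F" for F
    using cubic_necklace that no_perfect_matching_cover
    by (intro oddness_ge_2) (auto simp: card_verts_necklace)
  let ?F = "{e \<in> edges (necklace n). edge_shade n e \<noteq> 1}"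
  \<comment> \<open>Within the 2-factor of colours 2 and 3, colour 2 matches all vertices but the
    two conflicting hubs, so each odd circuit passes through one of them.\<close>
  let ?J = "{e \<in> edges (necklace n). edge_shade n e = 2}"
  have "card (odd_circuits (necklace n) ?F) \<le> card {vx 0 7, vx (n - 1) 7}"
    using shade_degree(3) by (intro card_odd_circuits_le[OF two_factor_shade, of ?J]) auto
  also have "\<dots> \<le> 2" by (simp add: card_insert_if)
  finally have "card (odd_circuits (necklace n) ?F) = 2" using ge[OF two_factor_shade] by simp
  then show "2 \<in> (\<lambda>F. card (odd_circuits (necklace n) F)) ` {F. two_factor (necklace n) F}"
    using two_factor_shade by (intro image_eqI[of _ _ ?F]) auto
  show "2 \<le> x" if "x \<in> (\<lambda>F. card (odd_circuits (necklace n) F)) ` {F. two_factor (necklace n) F}" for x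
    using that ge by auto
qed

lemma colouring_defect_necklace: "n \<le> 2 * colouring_defect (necklace n)"
proof -
  let ?A = "{card (edges (necklace n) - (M1 \<union> M2 \<union> M3)) |M1 M2 M3.
    perfect_matching (necklace n) M1 \<and> perfect_matching (necklace n) M2 \<and> perfect_matching (necklace n) M3}"
  let ?M = "{e \<in> edges (necklace n). edge_shade n e = 1}"
  \<comment> \<open>One perfect matching taken three times shows the set nonempty, so the infimum is
    attained.\<close>
  have "card (edges (necklace n) - (?M \<union> ?M \<union> ?M)) \<in> ?A"
    by (intro CollectI exI[of _ ?M] conjI refl perfect_matching_shade)
  then have "?A \<noteq> {}" by (intro notI) (simp only: empty_iff)
  then have "Inf ?A \<in> ?A" by (rule Inf_nat_def1)
  then obtain M1 M2 M3 where M: "perfect_matching (necklace n) M1" "perfect_matching (necklace n) M2"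
    "perfect_matching (necklace n) M3" "Inf ?A = card (edges (necklace n) - (M1 \<union> M2 \<union> M3))"
    by (elim CollectE exE conjE)
  interpret three_matchings n M1 M2 M3 by (rule three_matchings.intro) (use M in auto)
  show ?thesis unfolding colouring_defect_def M(4) by (rule card_uncovered)
qed

text \<open>Each of the three colours occurs once at every vertex, so the colour classes would be
  three perfect matchings that cover all edges.\<close>

lemma no_proper_3_colouring: "\<not> proper_edge_colouring (necklace n) 3 c"
proof
  assume c: "proper_edge_colouring (necklace n) 3 c"
  have pm: "perfect_matching (necklace n) {e \<in> edges (necklace n). c e = i}" if i: "i < 3" for i
    unfolding perfect_matching_iff
  proof (intro conjI ballI)
    fix v assume v: "v \<in> verts (necklace n)"
    then obtain l j where lj: "v = vx l j" by (auto elim: vert_cases)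
    note v' = v[unfolded lj]
    note star = star_subset[OF v'] distinct_star[OF v']
    have inc: "v \<in># ends (necklace n) e" if e: "e \<in> set (star n l j)" for e
    proof -
      have "e \<in> edges (necklace n)" using e star by blast
      then obtain l' t where "e = ed l' t" "l' < 3 * n" "t < 11" by (rule edge_cases)
      then have "count (ends (necklace n) e) v = 1" using count_ends_necklace[OF _ _ v'] e lj by simp
      then show ?thesis by (metis count_greater_zero_iff zero_less_one)
    qed
    have "c e \<noteq> c f" if "e \<in> set (star n l j)" "f \<in> set (star n l j)" "e \<noteq> f" for e f
      using c that inc[of e] inc[of f] star(1) unfolding proper_edge_colouring_def by blast
    then have d: "distinct (map c (star n l j))"
      using star(2) by (auto simp: distinct_map inj_on_def)
    moreover have "set (map c (star n l j)) \<subseteq> {..<3}"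
      using c star(1) by (auto simp: proper_edge_colouring_def)
    moreover have "card (set (map c (star n l j))) = 3"
      using distinct_card[OF d] length_star[OF v'] by simp
    ultimately have cs: "set (map c (star n l j)) = {..<3}" by (intro card_subset_eq) auto
    have "edge_degree (necklace n) {e \<in> edges (necklace n). c e = i} v =
        (\<Sum>e\<leftarrow>star n l j. of_bool (e \<in> {e \<in> edges (necklace n). c e = i}))"
      unfolding lj by (rule edge_degree_necklace[OF _ v']) auto
    also have "\<dots> = (\<Sum>e\<leftarrow>star n l j. of_bool (c e = i))"
      using star(1) by (intro arg_cong[where f = sum_list] map_cong) auto
    also have "\<dots> = (\<Sum>x\<leftarrow>map c (star n l j). of_bool (x = i))" by (simp add: o_def)
    also have "\<dots> = (\<Sum>x\<in>{..<3}. of_bool (x = i))"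
      by (simp only: sum_list_distinct_conv_sum_set[OF d] cs)
    also have "\<dots> = 1" using i by simp
    finally show "edge_degree (necklace n) {e \<in> edges (necklace n). c e = i} v = 1" .
  qed auto
  have "c e = 0 \<or> c e = 1 \<or> c e = 2" if "e \<in> edges (necklace n)" for e
  proof -
    have "c e < 3" using c that by (simp add: proper_edge_colouring_def)
    then show ?thesis by linarith
  qed
  then show False using no_perfect_matching_cover[OF pm[of 0] pm[of 1] pm[of 2]] by auto
qed

lemma nontrivial_snark_necklace: "nontrivial_snark (necklace n)"
  unfolding nontrivial_snark_def snark_def
  using finite_graph.fin[OF finite_necklace] k_connected_necklace[OF n(2)] cubic_necklace
    no_proper_3_colouring cyclically_4_edge_connected_necklace[OF n(2)] girth_necklace[OF n(2)] by blast

end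

theorem theorem5p1:
  fixes d :: int
  shows "\<exists>G :: (nat, nat) multigraph.
           nontrivial_snark G \<and> oddness G = 2 \<and> int (colouring_defect G) \<ge> d"
proof -
  \<comment> \<open>Even and positive, with half of it exceeding \<open>d\<close>;
    \<open>nat\<close> sends a negative \<open>d\<close> to 0.\<close>
  define n where "n = 2 * (nat d + 1)"
  have n: "even n" "0 < n" by (simp_all add: n_def)
  have "int (colouring_defect (necklace n)) \<ge> d"
    using colouring_defect_necklace[OF n] by (simp add: n_def)
  then show ?thesis using nontrivial_snark_necklace[OF n] oddness_necklace[OF n] by blast
qed

end
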